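(* Let $K$ be a field and let $n,p\geq 1$ be integers. Let $\mathcal{T}_n(p)$ be the $p$-triangular snake graph, let $S_{n,p}=K[V(\mathcal{T}_n(p))]$ and let $I_{n,p}\subset S_{n,p}$ be the edge ideal of $\mathcal{T}_n(p)$. Then $$\operatorname{reg}(S_{n,p}/I_{n,p})=\left\lceil\frac{n+1}{2}\right\rceil .$$
   Context: All graphs are finite, simple and undirected. For a graph $G$, $K[V(G)]$ denotes the polynomial ring over $K$ whose variables are the vertices of $G$, with standard grading (every variable has degree 1), and the edge ideal is $I(G)=(uv : \{u,v\}\in E(G))\subset K[V(G)]$. The $p$-triangular snake $\mathcal{T}_n(p)$ consists of $p$ triangular snakes sharing a common path on $n+1$ vertices. Explicitly, its vertex set is $\{x_1,\dots,x_{n+1}\}\cup\{y_{ij}:1\le i\le n,\ 1\le j\le p\}$ and its edge set is $\{\{x_i,x_{i+1}\}:1\le i\le n\}\cup\{\{x_i,y_{ij}\},\{x_{i+1},y_{ij}\}:1\le i\le n,\ 1\le j\le p\}$. For a finitely generated graded module $N$ over a standard graded polynomial ring with graded Betti numbers $\beta_{i,j}(N)$ (from the minimal graded free resolution), the Castelnuovo–Mumford regularity is $\operatorname{reg}(N)=\max\{j-i:\beta_{i,j}(N)\neq 0\}$. *)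

theory Defs
  imports Complex_Main "HOL-Library.Poly_Mapping" "HOL-Algebra.QuotRing" "HOL-Algebra.Module"
begin

section \<open>Polynomial rings with the standard grading\<close>

text \<open>A monomial is a finitely supported exponent vector, and the convolution product of
  \<^theory>\<open>HOL-Library.Poly_Mapping\<close> makes \<open>('v, 'k) mpoly\<close> the polynomial ring over \<open>'k\<close> whose
  variables are all elements of \<open>'v\<close>.  The ring \<open>K[V]\<close> is its subring of those polynomials
  that only involve variables from \<open>V\<close>.\<close>

type_synonym ('v, 'k) mpoly = "('v \<Rightarrow>\<^sub>0 nat) \<Rightarrow>\<^sub>0 'k"

definition poly_ring :: "'v set \<Rightarrow> ('v, 'k::field) mpoly ring" where
  "poly_ring V =
    \<lparr>carrier = {f. \<forall>m\<in>Poly_Mapping.keys f. Poly_Mapping.keys m \<subseteq> V},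
     mult = (*), one = 1, zero = 0, add = (+)\<rparr>"

definition Var :: "'v \<Rightarrow> ('v, 'k::field) mpoly" where
  "Var v = Poly_Mapping.single (Poly_Mapping.single v 1) 1"

definition mdeg :: "('v \<Rightarrow>\<^sub>0 nat) \<Rightarrow> nat" where
  "mdeg m = (\<Sum>v\<in>Poly_Mapping.keys m. Poly_Mapping.lookup m v)"

text \<open>The degree is an integer so that it can be shifted; the component is \<open>{0}\<close> in negative
  degrees.\<close>

definition homogeneous :: "'v set \<Rightarrow> int \<Rightarrow> ('v, 'k::field) mpoly set" where
  "homogeneous V d =
    {f \<in> carrier (poly_ring V). \<forall>m\<in>Poly_Mapping.keys f. int (mdeg m) = d}"

definition irrelevant_ideal :: "'v set \<Rightarrow> ('v, 'k::field) mpoly set" where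
  "irrelevant_ideal V = Idl\<^bsub>poly_ring V\<^esub> (Var ` V)"


section \<open>Graded modules and minimal graded free resolutions\<close>

text \<open>\<open>grade M d\<close> is the homogeneous component of degree \<open>d\<close>.  The fields \<open>mult\<close> and \<open>one\<close>,
  which \<^const>\<open>module\<close> leaves unconstrained, play no role.\<close>

record ('a, 'b) graded_module = "('a, 'b) module" +
  grade :: "int \<Rightarrow> 'b set"

definition graded_hom ::
    "'v set \<Rightarrow> (('v, 'k::field) mpoly, 'a, 'x) graded_module_scheme
     \<Rightarrow> (('v, 'k) mpoly, 'b, 'y) graded_module_scheme \<Rightarrow> ('a \<Rightarrow> 'b) set" where
  "graded_hom V M N =
    {h \<in> carrier M \<rightarrow> carrier N.
       (\<forall>x\<in>carrier M. \<forall>y\<in>carrier M. h (x \<oplus>\<^bsub>M\<^esub> y) = h x \<oplus>\<^bsub>N\<^esub> h y) \<and>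
       (\<forall>a\<in>carrier (poly_ring V). \<forall>x\<in>carrier M. h (a \<odot>\<^bsub>M\<^esub> x) = a \<odot>\<^bsub>N\<^esub> h x) \<and>
       (\<forall>d. h ` grade M d \<subseteq> grade N d)}"

text \<open>For \<open>S = K[V]\<close> and \<open>ds = [d\<^sub>0, \<dots>, d\<^bsub>r-1\<^esub>]\<close>, the graded free module
  \<open>S(-d\<^sub>0) \<oplus> \<dots> \<oplus> S(-d\<^bsub>r-1\<^esub>)\<close>, i.e. the \<open>k\<close>-th basis vector has degree \<open>d\<^sub>k\<close>.  Its elements are
  coordinate functions, vanishing from index \<open>r\<close> on.\<close>

definition graded_free ::
    "'v set \<Rightarrow> int list \<Rightarrow> (('v, 'k::field) mpoly, nat \<Rightarrow> ('v, 'k) mpoly) graded_module" where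
  "graded_free V ds =
    \<lparr>carrier = {u. (\<forall>k<length ds. u k \<in> carrier (poly_ring V)) \<and> (\<forall>k\<ge>length ds. u k = 0)},
     mult = undefined, one = undefined,
     zero = (\<lambda>k. 0), add = (\<lambda>u w k. u k + w k),
     smult = (\<lambda>a u k. a * u k),
     grade = (\<lambda>d. {u. (\<forall>k<length ds. u k \<in> homogeneous V (d - ds ! k)) \<and>
                      (\<forall>k\<ge>length ds. u k = 0)})\<rparr>"

text \<open>The sequence \<open>\<dots> \<rightarrow> F\<^sub>2 \<rightarrow> F\<^sub>1 \<rightarrow> F\<^sub>0 \<rightarrow> N \<rightarrow> 0\<close> with \<open>F\<^sub>i = graded_free V (ds i)\<close>,
  augmentation \<open>\<epsilon> : F\<^sub>0 \<rightarrow> N\<close> and differentials \<open>\<phi> i : F\<^bsub>i+1\<^esub> \<rightarrow> F\<^sub>i\<close> is exact, and minimal in the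
  sense that the image of \<open>\<phi> i\<close> lies in \<open>\<mm>F\<^sub>i\<close>, the vectors with all coordinates in the
  irrelevant ideal \<open>\<mm>\<close>.\<close>

definition minimal_graded_free_resolution ::
    "'v set \<Rightarrow> (('v, 'k::field) mpoly, 'b, 'y) graded_module_scheme \<Rightarrow> (nat \<Rightarrow> int list)
     \<Rightarrow> (nat \<Rightarrow> (nat \<Rightarrow> ('v, 'k) mpoly) \<Rightarrow> (nat \<Rightarrow> ('v, 'k) mpoly))
     \<Rightarrow> ((nat \<Rightarrow> ('v, 'k) mpoly) \<Rightarrow> 'b) \<Rightarrow> bool" where
  "minimal_graded_free_resolution V N ds \<phi> \<epsilon> \<longleftrightarrow>
    (let F = (\<lambda>i. graded_free V (ds i)) in
      \<epsilon> \<in> graded_hom V (F 0) N \<and>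
      (\<forall>i. \<phi> i \<in> graded_hom V (F (Suc i)) (F i)) \<and>
      \<epsilon> ` carrier (F 0) = carrier N \<and>
      \<phi> 0 ` carrier (F 1) = a_kernel (F 0) N \<epsilon> \<and>
      (\<forall>i. \<phi> (Suc i) ` carrier (F (Suc (Suc i))) = a_kernel (F (Suc i)) (F i) (\<phi> i)) \<and>
      (\<forall>i. \<forall>u\<in>carrier (F (Suc i)). \<forall>k<length (ds i). \<phi> i u k \<in> irrelevant_ideal V))"

text \<open>\<open>betti V N i j\<close> is the number of summands \<open>S(-j)\<close> in the \<open>i\<close>-th module of a minimal graded
  free resolution of \<open>N\<close>.  For a finitely generated graded module such a resolution exists and is
  unique up to isomorphism, so the choice is immaterial.\<close>

definition betti ::
    "'v set \<Rightarrow> (('v, 'k::field) mpoly, 'b, 'y) graded_module_scheme \<Rightarrow> nat \<Rightarrow> int \<Rightarrow> nat" where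
  "betti V N i j =
    (let ds = (SOME ds. \<exists>\<phi> \<epsilon>. minimal_graded_free_resolution V N ds \<phi> \<epsilon>)
     in count_list (ds i) j)"

definition regularity ::
    "'v set \<Rightarrow> (('v, 'k::field) mpoly, 'b, 'y) graded_module_scheme \<Rightarrow> int" where
  "regularity V N = Max {j - int i | i j. betti V N i j \<noteq> 0}"

text \<open>\<open>S/I\<close> as a graded \<open>S\<close>-module, where \<open>S = K[V]\<close>: a scalar acts through its residue class,
  and the component of degree \<open>d\<close> consists of the residue classes of \<open>S\<^sub>d\<close>.\<close>

definition quotient_module ::
    "'v set \<Rightarrow> ('v, 'k::field) mpoly set \<Rightarrow> (('v, 'k) mpoly, ('v, 'k) mpoly set) graded_module"
  where
  "quotient_module V I =
    (let S = poly_ring V; Q = S Quot I in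
     \<lparr>carrier = carrier Q, mult = mult Q, one = one Q, zero = zero Q, add = add Q,
      smult = (\<lambda>a x. (I +>\<^bsub>S\<^esub> a) \<otimes>\<^bsub>Q\<^esub> x),
      grade = (\<lambda>d. {I +>\<^bsub>S\<^esub> f | f. f \<in> homogeneous V d})\<rparr>)"


section \<open>Edge ideals and triangular snakes\<close>

record 'v graph =
  verts :: "'v set"
  edges :: "'v set set"

definition simple_graph :: "'v graph \<Rightarrow> bool" where
  "simple_graph G \<longleftrightarrow> finite (verts G) \<and> (\<forall>e\<in>edges G. e \<subseteq> verts G \<and> card e = 2)"

definition edge_ideal :: "'v graph \<Rightarrow> ('v, 'k::field) mpoly set" where
  "edge_ideal G = Idl\<^bsub>poly_ring (verts G)\<^esub> {Var u * Var v | u v. {u, v} \<in> edges G}"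

datatype snake_vertex = X nat | Y nat nat

definition triangular_snake :: "nat \<Rightarrow> nat \<Rightarrow> snake_vertex graph" where
  "triangular_snake n p =
    \<lparr>verts = {X i | i. i \<in> {1..n+1}} \<union> {Y i j | i j. i \<in> {1..n} \<and> j \<in> {1..p}},
     edges = {{X i, X (i + 1)} | i. i \<in> {1..n}} \<union>
             {{X i, Y i j} | i j. i \<in> {1..n} \<and> j \<in> {1..p}} \<union>
             {{X (i + 1), Y i j} | i j. i \<in> {1..n} \<and> j \<in> {1..p}}\<rparr>"


section \<open>Well-formedness\<close>

lemma simple_graph_triangular_snake: "simple_graph (triangular_snake n p)"
proof -
  have "verts (triangular_snake n p) =
      X ` {1..n+1} \<union> (\<lambda>(i, j). Y i j) ` ({1..n} \<times> {1..p})"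
    by (auto simp: triangular_snake_def)
  then have "finite (verts (triangular_snake n p))"
    by simp
  then show ?thesis
    unfolding simple_graph_def by (auto simp: triangular_snake_def)
qed

lemma cring_poly_ring: "cring (poly_ring V :: ('v, 'k::field) mpoly ring)"
proof (rule cringI)
  show "abelian_group (poly_ring V :: ('v, 'k) mpoly ring)"
  proof (rule abelian_groupI)
    fix f g :: "('v, 'k) mpoly"
    assume "f \<in> carrier (poly_ring V)" "g \<in> carrier (poly_ring V)"
    then show "f \<oplus>\<^bsub>poly_ring V\<^esub> g \<in> carrier (poly_ring V)"
      using keys_add[of f g] by (fastforce simp: poly_ring_def)
  next
    fix f :: "('v, 'k) mpoly"
    assume "f \<in> carrier (poly_ring V)"
    then show "\<exists>g\<in>carrier (poly_ring V). g \<oplus>\<^bsub>poly_ring V\<^esub> f = \<zero>\<^bsub>poly_ring V\<^esub>"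
      by (intro bexI[of _ "- f"]) (auto simp: poly_ring_def in_keys_iff)
  qed (auto simp: poly_ring_def algebra_simps)
next
  show "comm_monoid (poly_ring V :: ('v, 'k) mpoly ring)"
  proof (rule comm_monoidI)
    fix f g :: "('v, 'k) mpoly"
    assume fg: "f \<in> carrier (poly_ring V)" "g \<in> carrier (poly_ring V)"
    have "Poly_Mapping.keys m \<subseteq> V" if m: "m \<in> Poly_Mapping.keys (f * g)" for m
    proof -
      obtain a b where "m = a + b" "a \<in> Poly_Mapping.keys f" "b \<in> Poly_Mapping.keys g"
        using m keys_mult[of f g] by auto
      then show ?thesis
        using fg keys_add[of a b] by (fastforce simp: poly_ring_def)
    qed
    then show "f \<otimes>\<^bsub>poly_ring V\<^esub> g \<in> carrier (poly_ring V)"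
      by (simp add: poly_ring_def)
  qed (auto simp: poly_ring_def algebra_simps)
qed (auto simp: poly_ring_def algebra_simps)

lemma ideal_edge_ideal:
  assumes "simple_graph G"
  shows "ideal (edge_ideal G :: ('v, 'k::field) mpoly set) (poly_ring (verts G))"
proof -
  interpret cring "poly_ring (verts G) :: ('v, 'k) mpoly ring"
    by (rule cring_poly_ring)
  have "{Var u * Var v | u v. {u, v} \<in> edges G} \<subseteq>
      carrier (poly_ring (verts G) :: ('v, 'k) mpoly ring)"
  proof clarify
    fix u v assume "{u, v} \<in> edges G"
    then have "u \<in> verts G" "v \<in> verts G"
      using assms by (auto simp: simple_graph_def)
    then have "(Var u :: ('v, 'k) mpoly) \<in> carrier (poly_ring (verts G))"
         "(Var v :: ('v, 'k) mpoly) \<in> carrier (poly_ring (verts G))"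
      by (auto simp: poly_ring_def Var_def)
    from m_closed[OF this] show "(Var u * Var v :: ('v, 'k) mpoly) \<in> carrier (poly_ring (verts G))"
      by (simp add: poly_ring_def)
  qed
  then show ?thesis
    unfolding edge_ideal_def by (rule genideal_ideal)
qed

lemma module_graded_free:
  "module (poly_ring V) (graded_free V ds ::
     (('v, 'k::field) mpoly, nat \<Rightarrow> ('v, 'k) mpoly) graded_module)"
proof -
  let ?S = "poly_ring V :: ('v, 'k) mpoly ring"
  let ?F = "graded_free V ds :: (('v, 'k) mpoly, nat \<Rightarrow> ('v, 'k) mpoly) graded_module"
  interpret cring ?S
    by (rule cring_poly_ring)
  have ops: "f \<otimes>\<^bsub>?S\<^esub> g = f * g" "f \<oplus>\<^bsub>?S\<^esub> g = f + g" "\<one>\<^bsub>?S\<^esub> = 1" "\<zero>\<^bsub>?S\<^esub> = 0" for f g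
    by (simp_all add: poly_ring_def)
  have neg: "- f \<in> carrier ?S" if "f \<in> carrier ?S" for f
    using that by (auto simp: poly_ring_def in_keys_iff)
  note closed = m_closed[unfolded ops] a_closed[unfolded ops] zero_closed[unfolded ops]
  show ?thesis
  proof (rule moduleI[OF cring_poly_ring])
    show "abelian_group ?F"
    proof (rule abelian_groupI)
      fix u assume "u \<in> carrier ?F"
      then show "\<exists>w\<in>carrier ?F. w \<oplus>\<^bsub>?F\<^esub> u = \<zero>\<^bsub>?F\<^esub>"
        by (intro bexI[of _ "\<lambda>k. - u k"]) (auto simp: graded_free_def neg)
    qed (auto simp: graded_free_def closed algebra_simps)
  qed (auto simp: graded_free_def ops closed algebra_simps)
qed

lemma module_quotient_module:
  assumes "ideal I (poly_ring V)"
  shows "module (poly_ring V) (quotient_module V I)"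
proof -
  interpret I: ideal I "poly_ring V" by fact
  interpret S: cring "poly_ring V" by (rule cring_poly_ring)
  interpret Q: cring "poly_ring V Quot I"
    by (rule I.quotient_is_cring) (rule cring_poly_ring)
  interpret h: ring_hom_ring "poly_ring V" "poly_ring V Quot I" "(+>\<^bsub>poly_ring V\<^esub>) I"
    by (rule I.rcos_ring_hom_ring)
  have q: "carrier (quotient_module V I) = carrier (poly_ring V Quot I)"
    "zero (quotient_module V I) = zero (poly_ring V Quot I)"
    "add (quotient_module V I) = add (poly_ring V Quot I)"
    "smult (quotient_module V I) =
      (\<lambda>a x. (I +>\<^bsub>poly_ring V\<^esub> a) \<otimes>\<^bsub>poly_ring V Quot I\<^esub> x)"
    by (simp_all add: quotient_module_def Let_def)
  show ?thesis
  proof (rule moduleI[OF cring_poly_ring])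
    show "abelian_group (quotient_module V I)"
      by (rule abelian_groupI)
        (simp_all add: q Q.a_ac Q.add.l_inv_ex)
  qed (auto simp: q Q.l_distr Q.r_distr Q.m_assoc)
qed

end

theory Submission
  imports Defs "HOL-Library.Function_Algebras"
begin

text \<open>Adding one edge \<open>uv\<close> to a graph \<open>E\<close> changes the ideal \<open>I = I(E)\<close> to \<open>I + (uv)\<close>, and multiplication by
\<open>uv\<close> gives an exact sequence \<open>0 \<rightarrow> S/(I : uv)(-2) \<rightarrow> S/I \<rightarrow> S/(I + (uv)) \<rightarrow> 0\<close>.  So the mapping cone of a
comparison map between minimal resolutions of the first two modules resolves the third.  Suppose
that every neighbour of \<open>v\<close> in \<open>E\<close> is a neighbour of \<open>u\<close>.  Then \<open>I : u\<close> is generated by the neighbours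
of \<open>u\<close> and by the edges avoiding them; \<open>v\<close> divides none of these generators, whence
\<open>I : uv = I : u\<close>.  Therefore multiplication by \<open>uv\<close> factors as multiplication by \<open>v\<close> on \<open>S/(I : u)\<close> followed by
multiplication by \<open>u\<close>, and the comparison map can be taken to be \<open>v\<close> times a lift of the latter.
Its entries lie in the irrelevant ideal, so the cone is again minimal (\<open>mapping_cone\<close>) and
\<open>reg S/(I + (uv)) = max (reg S/I) (reg S/(I : u) + 1)\<close> over every field.  The variables among the
generators of \<open>I : u\<close> leave its regularity unchanged, since adjoining a variable that occurs in no
generator is the same cone construction with \<open>u\<close> replaced by \<open>1\<close>.  The result is
\<open>has_reg_insert_edge\<close>.

A snake is built by adding its edges strip by strip.  In each strip the path edge \<open>x\<^sub>k x\<^bsub>k+1\<^esub>\<close> comes first,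
then the edges \<open>x\<^sub>k y\<^bsub>kj\<^esub>\<close>, then the edges \<open>x\<^bsub>k+1\<^esub> y\<^bsub>kj\<^esub>\<close>; the condition on neighbourhoods always holds, and
the edges that survive in the colon ideal form a shorter snake with pendant edges at its last vertex.
If \<open>e\<^sub>k\<close> is the regularity of the snake with \<open>k\<close> strips and \<open>h\<^sub>k\<close> that of the snake with \<open>k - 1\<close> strips and
\<open>p\<close> pendant edges at \<open>x\<^sub>k\<close>, then \<open>h\<^sub>k = max e\<^bsub>k-1\<^esub> (h\<^bsub>k-2\<^esub> + 1)\<close> and
\<open>e\<^sub>k = max e\<^bsub>k-1\<^esub> (max (h\<^bsub>k-2\<^esub> + 1) (h\<^bsub>k-1\<^esub> + 1))\<close> for \<open>k \<ge> 1\<close>, starting from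
\<open>e\<^sub>0 = h\<^sub>0 = h\<^bsub>-1\<^esub> = 0\<close>; this gives \<open>h\<^sub>k = \<lceil>k/2\<rceil>\<close> and \<open>e\<^sub>k = \<lceil>(k+1)/2\<rceil>\<close> for \<open>k \<ge> 1\<close>.

The regularity is read off from an arbitrarily chosen minimal resolution, so it also has to be shown
that the set of twists in each homological degree does not depend on the choice
(\<open>shifts_unique\<close>).  Comparison maps in both directions compose to a self-map that is homotopic to the identity;
modulo the irrelevant ideal the homotopy terms vanish, so a basis vector of degree \<open>j\<close> cannot factor through a free module without
generators of degree \<open>j\<close>.\<close>

section \<open>Polynomials\<close>

abbreviation polys :: "'v set \<Rightarrow> ('v, 'k::field) mpoly set" where
  "polys V \<equiv> carrier (poly_ring V)"

lemma polys_iff: "f \<in> polys V \<longleftrightarrow> (\<forall>m\<in>Poly_Mapping.keys f. Poly_Mapping.keys m \<subseteq> V)"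
  by (simp add: poly_ring_def)

lemma poly_ring_sel [simp]:
  "mult (poly_ring V) = (*)" "one (poly_ring V) = 1" "zero (poly_ring V) = 0" "add (poly_ring V) = (+)"
  by (simp_all add: poly_ring_def)

lemma polys_zero [simp]: "0 \<in> polys V"
  by (simp add: polys_iff)

lemma polys_one [simp]: "1 \<in> polys V"
  by (simp add: polys_iff)

lemma polys_add: "f \<in> polys V \<Longrightarrow> g \<in> polys V \<Longrightarrow> f + g \<in> polys V"
  using abelian_monoid.a_closed[OF ring.is_abelian_group[THEN abelian_group.axioms(1)]]
    cring.axioms(1)[OF cring_poly_ring, of V] by fastforce

lemma polys_mult: "f \<in> polys V \<Longrightarrow> g \<in> polys V \<Longrightarrow> f * g \<in> polys V"
  using monoid.m_closed[OF ring.is_monoid] cring.axioms(1)[OF cring_poly_ring, of V] by fastforce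

lemma polys_uminus: "f \<in> polys V \<Longrightarrow> - f \<in> polys V"
  by (auto simp: polys_iff in_keys_iff)

lemma polys_diff: "f \<in> polys V \<Longrightarrow> g \<in> polys V \<Longrightarrow> f - g \<in> polys V"
  using polys_add[of f V "- g"] polys_uminus[of g V] by simp

lemma polys_sum: "(\<And>k. k \<in> A \<Longrightarrow> f k \<in> polys V) \<Longrightarrow> sum f A \<in> polys V"
  by (induction A rule: infinite_finite_induct) (auto intro: polys_add)

lemma Var_polys [simp]: "Var v \<in> polys V \<longleftrightarrow> v \<in> V"
  by (auto simp: polys_iff Var_def)

lemma mdeg_superset:
  assumes "finite A" "Poly_Mapping.keys m \<subseteq> A"
  shows "mdeg m = (\<Sum>v\<in>A. Poly_Mapping.lookup m v)"
  unfolding mdeg_def using assms by (intro sum.mono_neutral_left) (auto simp: in_keys_iff)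

lemma mdeg_add: "mdeg (a + b) = mdeg a + mdeg b"
proof -
  let ?A = "Poly_Mapping.keys a \<union> Poly_Mapping.keys b"
  have "Poly_Mapping.keys (a + b) \<subseteq> ?A" by (rule keys_add)
  then show ?thesis
    by (simp add: mdeg_superset[of ?A] lookup_add sum.distrib)
qed

lemma mdeg_zero [simp]: "mdeg 0 = 0"
  by (simp add: mdeg_def)

lemma homogeneous_iff: "f \<in> homogeneous V d \<longleftrightarrow> f \<in> polys V \<and> (\<forall>m\<in>Poly_Mapping.keys f. int (mdeg m) = d)"
  by (simp add: homogeneous_def)

lemma homogeneous_polys: "f \<in> homogeneous V d \<Longrightarrow> f \<in> polys V"
  by (simp add: homogeneous_iff)

lemma homogeneous_zero [simp]: "0 \<in> homogeneous V d"
  by (simp add: homogeneous_iff)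

lemma homogeneous_one [simp]: "1 \<in> homogeneous V 0"
  by (simp add: homogeneous_iff)

lemma homogeneous_Var: "v \<in> V \<Longrightarrow> Var v \<in> homogeneous V 1"
  by (simp add: homogeneous_iff) (simp add: Var_def mdeg_def)

lemma homogeneous_add: "f \<in> homogeneous V d \<Longrightarrow> g \<in> homogeneous V d \<Longrightarrow> f + g \<in> homogeneous V d"
  using keys_add[of f g] by (fastforce simp: homogeneous_iff intro: polys_add)

lemma homogeneous_uminus: "f \<in> homogeneous V d \<Longrightarrow> - f \<in> homogeneous V d"
  by (auto simp: homogeneous_iff polys_uminus in_keys_iff)

lemma homogeneous_sum: "(\<And>k. k \<in> A \<Longrightarrow> f k \<in> homogeneous V d) \<Longrightarrow> sum f A \<in> homogeneous V d"
  by (induction A rule: infinite_finite_induct) (auto intro: homogeneous_add)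

lemma homogeneous_mult:
  assumes "f \<in> homogeneous V c" "g \<in> homogeneous V d"
  shows "f * g \<in> homogeneous V (c + d)"
proof -
  have "int (mdeg m) = c + d" if m: "m \<in> Poly_Mapping.keys (f * g)" for m
  proof -
    obtain a b where "m = a + b" "a \<in> Poly_Mapping.keys f" "b \<in> Poly_Mapping.keys g"
      using m keys_mult[of f g] by auto
    then show ?thesis
      using assms by (auto simp: homogeneous_iff mdeg_add)
  qed
  then show ?thesis
    using assms by (auto simp: homogeneous_iff intro: polys_mult)
qed

definition hcomp :: "int \<Rightarrow> ('v, 'k::field) mpoly \<Rightarrow> ('v, 'k) mpoly" where
  "hcomp d f = (\<Sum>m\<in>{m \<in> Poly_Mapping.keys f. int (mdeg m) = d}.
     Poly_Mapping.single m (Poly_Mapping.lookup f m))"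

lemma lookup_hcomp:
  "Poly_Mapping.lookup (hcomp d f) m = (if int (mdeg m) = d then Poly_Mapping.lookup f m else 0)"
proof -
  have "Poly_Mapping.lookup (hcomp d f) m =
      (\<Sum>m'\<in>{m \<in> Poly_Mapping.keys f. int (mdeg m) = d}.
         if m' = m then Poly_Mapping.lookup f m' else 0)"
    by (simp add: hcomp_def lookup_sum lookup_single when_def)
  also have "\<dots> = (if int (mdeg m) = d then Poly_Mapping.lookup f m else 0)"
    by (auto simp: in_keys_iff)
  finally show ?thesis .
qed

lemma keys_hcomp: "Poly_Mapping.keys (hcomp d f) = {m \<in> Poly_Mapping.keys f. int (mdeg m) = d}"
  by (auto simp: in_keys_iff lookup_hcomp split: if_splits)

lemma hcomp_homogeneous: "f \<in> polys V \<Longrightarrow> hcomp d f \<in> homogeneous V d"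
  by (auto simp: homogeneous_iff polys_iff keys_hcomp)

lemma hcomp_add: "hcomp d (f + g) = hcomp d f + hcomp d g"
  by (rule poly_mapping_eqI) (simp add: lookup_hcomp lookup_add)

lemma hcomp_diff: "hcomp d (f - g) = hcomp d f - hcomp d g"
  by (rule poly_mapping_eqI) (simp add: lookup_hcomp lookup_minus)

lemma hcomp_zero [simp]: "hcomp d 0 = 0"
  by (rule poly_mapping_eqI) (simp add: lookup_hcomp)

lemma hcomp_sum: "hcomp d (sum f A) = (\<Sum>k\<in>A. hcomp d (f k))"
  by (induction A rule: infinite_finite_induct) (auto simp: hcomp_add)

lemma hcomp_id: "f \<in> homogeneous V d \<Longrightarrow> hcomp d f = f"
  by (rule poly_mapping_eqI) (auto simp: lookup_hcomp homogeneous_iff in_keys_iff)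

lemma hcomp_eq_0: "(\<And>m. m \<in> Poly_Mapping.keys f \<Longrightarrow> int (mdeg m) \<noteq> d) \<Longrightarrow> hcomp d f = 0"
  by (rule poly_mapping_eqI) (auto simp: lookup_hcomp in_keys_iff)

text \<open>Split \<open>f\<close> into its component of degree \<open>d - c\<close> and the rest; the rest contributes to no monomial of
degree \<open>d\<close> in the product.\<close>

lemma hcomp_mult_homogeneous:
  assumes "f \<in> polys V" "h \<in> homogeneous V c"
  shows "hcomp d (f * h) = hcomp (d - c) f * h"
proof -
  let ?f0 = "hcomp (d - c) f"
  have "?f0 * h \<in> homogeneous V d"
    using homogeneous_mult[OF hcomp_homogeneous[OF assms(1), of "d - c"] assms(2)] by simp
  then have 1: "hcomp d (?f0 * h) = ?f0 * h"
    by (rule hcomp_id)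
  have 2: "hcomp d ((f - ?f0) * h) = 0"
  proof (rule hcomp_eq_0)
    fix m assume "m \<in> Poly_Mapping.keys ((f - ?f0) * h)"
    then obtain a b where ab: "m = a + b" "a \<in> Poly_Mapping.keys (f - ?f0)" "b \<in> Poly_Mapping.keys h"
      using keys_mult[of "f - ?f0" h] by auto
    then have "int (mdeg a) \<noteq> d - c"
      by (auto simp: in_keys_iff lookup_minus lookup_hcomp split: if_splits)
    moreover have "int (mdeg b) = c"
      using ab(3) assms(2) by (auto simp: homogeneous_iff)
    ultimately show "int (mdeg m) \<noteq> d"
      by (simp add: ab(1) mdeg_add)
  qed
  have "f * h = ?f0 * h + (f - ?f0) * h"
    by (simp add: algebra_simps)
  then have "hcomp d (f * h) = hcomp d (?f0 * h) + hcomp d ((f - ?f0) * h)"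
    by (simp only: hcomp_add)
  with 1 2 show ?thesis by simp
qed

text \<open>Exponent vectors have no negative entries, so a constant term of a product comes from constant terms
of both factors.  This is how reduction modulo the irrelevant ideal is carried out below.\<close>

lemma no_constant_term_mult:
  assumes "0 \<notin> Poly_Mapping.keys f"
  shows "0 \<notin> Poly_Mapping.keys (f * g :: ('v, 'k::field) mpoly)"
proof
  assume "0 \<in> Poly_Mapping.keys (f * g)"
  then obtain a b where "0 = a + b" "a \<in> Poly_Mapping.keys f"
    using keys_mult[of f g] by auto
  moreover from \<open>0 = a + b\<close> have "a = 0"
    by (metis add_eq_0_iff_both_eq_0 lookup_add lookup_zero poly_mapping_eqI)
  ultimately show False using assms by simp
qed

lemma no_constant_term_sum:
  "(\<And>k. k \<in> A \<Longrightarrow> 0 \<notin> Poly_Mapping.keys (f k)) \<Longrightarrow> 0 \<notin> Poly_Mapping.keys (sum f A)"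
  by (simp add: in_keys_iff lookup_sum)

lemma ideal_poly_ringI:
  fixes I :: "('v, 'k::field) mpoly set"
  assumes "I \<subseteq> polys V" "0 \<in> I" "\<And>f g. f \<in> I \<Longrightarrow> g \<in> I \<Longrightarrow> f + g \<in> I"
    and "\<And>a f. a \<in> polys V \<Longrightarrow> f \<in> I \<Longrightarrow> a * f \<in> I"
  shows "ideal I (poly_ring V)"
proof (rule idealI)
  interpret cring "poly_ring V" by (rule cring_poly_ring)
  show "ring (poly_ring V)" by (rule ring_axioms)
  have "inv\<^bsub>add_monoid (poly_ring V)\<^esub> a \<in> I" if "a \<in> I" for a
  proof -
    have "a \<in> polys V" using that assms(1) by auto
    then have "\<ominus>\<^bsub>poly_ring V\<^esub> a = - a"
      using minus_equality[of "- a" a] by (simp add: polys_uminus)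
    moreover have "- 1 * a \<in> I"
      by (rule assms(4)[OF polys_uminus that]) simp
    ultimately show ?thesis by (simp add: a_inv_def)
  qed
  then show "subgroup I (add_monoid (poly_ring V))"
    using assms by unfold_locales (auto)
  fix a x :: "('v, 'k) mpoly" assume "a \<in> I" "x \<in> polys V"
  then have "x * a \<in> I" by (rule assms(4)[rotated])
  then show "x \<otimes>\<^bsub>poly_ring V\<^esub> a \<in> I" "a \<otimes>\<^bsub>poly_ring V\<^esub> x \<in> I"
    by (simp_all add: mult.commute)
qed

lemma ideal_props:
  assumes "ideal I (poly_ring V)"
  shows "I \<subseteq> polys V" "0 \<in> I" "\<And>f g. f \<in> I \<Longrightarrow> g \<in> I \<Longrightarrow> f + g \<in> I"
    and "\<And>a f. a \<in> polys V \<Longrightarrow> f \<in> I \<Longrightarrow> a * f \<in> I"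
    and "\<And>f. f \<in> I \<Longrightarrow> - f \<in> I"
    and "\<And>f g. f \<in> I \<Longrightarrow> g \<in> I \<Longrightarrow> f - g \<in> I"
proof -
  interpret ideal I "poly_ring V" by fact
  show 1: "I \<subseteq> polys V" "0 \<in> I" "\<And>f g. f \<in> I \<Longrightarrow> g \<in> I \<Longrightarrow> f + g \<in> I"
    using a_subset additive_subgroup.a_closed[OF additive_subgroup_axioms]
      additive_subgroup.zero_closed[OF additive_subgroup_axioms] by simp_all
  show 2: "a * f \<in> I" if "a \<in> polys V" "f \<in> I" for a f
    using I_l_closed[OF that(2) that(1)] by simp
  show 3: "- f \<in> I" if "f \<in> I" for f
    using 2[OF polys_uminus[OF polys_one] that] by simp
  show "f - g \<in> I" if "f \<in> I" "g \<in> I" for f g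
    using 1(3)[OF that(1) 3[OF that(2)]] by simp
qed

lemma irrelevant_ideal_is_ideal: "ideal (irrelevant_ideal V) (poly_ring V)"
  unfolding irrelevant_ideal_def
  by (rule ring.genideal_ideal) (use cring.axioms(1)[OF cring_poly_ring] in auto)

lemma Var_in_irrelevant_ideal: "v \<in> V \<Longrightarrow> Var v \<in> irrelevant_ideal V"
  unfolding irrelevant_ideal_def
  by (rule subsetD[OF ring.genideal_self]) (use cring.axioms(1)[OF cring_poly_ring] in auto)

lemma irrelevant_ideal_no_constant_term:
  fixes f :: "('a, 'b::field) mpoly"
  assumes "f \<in> irrelevant_ideal V"
  shows "0 \<notin> Poly_Mapping.keys f"
proof -
  let ?J = "{f \<in> polys V :: ('a, 'b) mpoly set. 0 \<notin> Poly_Mapping.keys f}"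
  have J: "ideal ?J (poly_ring V)"
  proof (rule ideal_poly_ringI)
    fix f g :: "('a, 'b) mpoly" assume "f \<in> ?J" "g \<in> ?J"
    then show "f + g \<in> ?J" using keys_add[of f g] by (auto intro: polys_add)
  next
    fix a f :: "('a, 'b) mpoly" assume "a \<in> polys V" "f \<in> ?J"
    then show "a * f \<in> ?J"
      using no_constant_term_mult[of f a] by (auto intro: polys_mult simp: mult.commute)
  qed auto
  have "Poly_Mapping.single v (1::nat) \<noteq> 0" for v :: 'a
    by (metis one_neq_zero lookup_single_eq lookup_zero)
  then have "Var v \<in> ?J" if "v \<in> V" for v
    using that by (simp add: in_keys_iff Var_def lookup_single when_def) (simp add: polys_iff)
  then have "irrelevant_ideal V \<subseteq> ?J"
    unfolding irrelevant_ideal_def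
    by (intro ring.genideal_minimal[OF _ J]) (use cring.axioms(1)[OF cring_poly_ring] in auto)
  with assms show ?thesis by auto
qed

section \<open>Graded free modules\<close>

abbreviation vecs :: "'v set \<Rightarrow> int list \<Rightarrow> (nat \<Rightarrow> ('v, 'k::field) mpoly) set" where
  "vecs V ds \<equiv> carrier (graded_free V ds)"

abbreviation hom_free ::
    "'v set \<Rightarrow> int list \<Rightarrow> int list \<Rightarrow> ((nat \<Rightarrow> ('v, 'k::field) mpoly) \<Rightarrow> (nat \<Rightarrow> ('v, 'k) mpoly)) set" where
  "hom_free V ds es \<equiv> graded_hom V (graded_free V ds) (graded_free V es)"

abbreviation scale :: "('v, 'k::field) mpoly \<Rightarrow> (nat \<Rightarrow> ('v, 'k) mpoly) \<Rightarrow> (nat \<Rightarrow> ('v, 'k) mpoly)" where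
  "scale a u \<equiv> (\<lambda>k. a * u k)"

definition basis_vec :: "nat \<Rightarrow> nat \<Rightarrow> ('v, 'k::field) mpoly" where
  "basis_vec k = (\<lambda>l. if l = k then 1 else 0)"

definition lin_ext :: "nat \<Rightarrow> (nat \<Rightarrow> nat \<Rightarrow> ('v, 'k::field) mpoly) \<Rightarrow> (nat \<Rightarrow> ('v, 'k) mpoly) \<Rightarrow> (nat \<Rightarrow> ('v, 'k) mpoly)" where
  "lin_ext r b u = (\<lambda>l. \<Sum>k<r. u k * b k l)"

lemma vecs_iff: "u \<in> vecs V ds \<longleftrightarrow> (\<forall>k<length ds. u k \<in> polys V) \<and> (\<forall>k\<ge>length ds. u k = 0)"
  by (simp add: graded_free_def)

lemma graded_free_sel [simp]:
  "zero (graded_free V ds) = 0" "add (graded_free V ds) = (+)"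
  "smult (graded_free V ds) = (\<lambda>a u k. a * u k)"
  by (simp_all add: graded_free_def fun_eq_iff)

lemma grade_free_iff:
  "u \<in> grade (graded_free V ds) d \<longleftrightarrow>
    (\<forall>k<length ds. u k \<in> homogeneous V (d - ds ! k)) \<and> (\<forall>k\<ge>length ds. u k = 0)"
  by (simp add: graded_free_def)

lemma grade_free_vecs: "u \<in> grade (graded_free V ds) d \<Longrightarrow> u \<in> vecs V ds"
  by (auto simp: grade_free_iff vecs_iff homogeneous_polys)

lemma vecs_polys: "u \<in> vecs V ds \<Longrightarrow> u k \<in> polys V"
  by (cases "k < length ds") (auto simp: vecs_iff)

lemma vecs_zero [simp]: "0 \<in> vecs V ds"
  by (simp add: vecs_iff)

lemma vecs_add: "u \<in> vecs V ds \<Longrightarrow> w \<in> vecs V ds \<Longrightarrow> u + w \<in> vecs V ds"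
  by (auto simp: vecs_iff intro: polys_add)

lemma vecs_diff: "u \<in> vecs V ds \<Longrightarrow> w \<in> vecs V ds \<Longrightarrow> u - w \<in> vecs V ds"
  by (auto simp: vecs_iff intro: polys_diff)

lemma vecs_uminus: "u \<in> vecs V ds \<Longrightarrow> - u \<in> vecs V ds"
  by (auto simp: vecs_iff intro: polys_uminus)

lemma vecs_scale: "a \<in> polys V \<Longrightarrow> u \<in> vecs V ds \<Longrightarrow> scale a u \<in> vecs V ds"
  by (auto simp: vecs_iff intro: polys_mult)

lemma basis_vec_vecs: "k < length ds \<Longrightarrow> basis_vec k \<in> vecs V ds"
  by (simp add: vecs_iff basis_vec_def)

lemma basis_vec_grade: "k < length ds \<Longrightarrow> basis_vec k \<in> grade (graded_free V ds) (ds ! k)"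
  by (simp add: grade_free_iff basis_vec_def)

lemma hom_freeI:
  assumes "\<And>u. u \<in> vecs V ds \<Longrightarrow> h u \<in> vecs V es"
    and "\<And>u w. u \<in> vecs V ds \<Longrightarrow> w \<in> vecs V ds \<Longrightarrow> h (u + w) = h u + h w"
    and "\<And>a u. a \<in> polys V \<Longrightarrow> u \<in> vecs V ds \<Longrightarrow> h (scale a u) = scale a (h u)"
    and "\<And>d u. u \<in> grade (graded_free V ds) d \<Longrightarrow> h u \<in> grade (graded_free V es) d"
  shows "h \<in> hom_free V ds es"
  using assms unfolding graded_hom_def by auto

lemma hom_free_vecs: "h \<in> hom_free V ds es \<Longrightarrow> u \<in> vecs V ds \<Longrightarrow> h u \<in> vecs V es"
  unfolding graded_hom_def by auto

lemma hom_free_add: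
  "h \<in> hom_free V ds es \<Longrightarrow> u \<in> vecs V ds \<Longrightarrow> w \<in> vecs V ds \<Longrightarrow> h (u + w) = h u + h w"
  unfolding graded_hom_def by auto

lemma hom_free_scale:
  "h \<in> hom_free V ds es \<Longrightarrow> a \<in> polys V \<Longrightarrow> u \<in> vecs V ds \<Longrightarrow> h (scale a u) = scale a (h u)"
  unfolding graded_hom_def by auto

lemma hom_free_grade:
  "h \<in> hom_free V ds es \<Longrightarrow> u \<in> grade (graded_free V ds) d \<Longrightarrow> h u \<in> grade (graded_free V es) d"
  unfolding graded_hom_def by (simp add: image_subset_iff)

lemma hom_free_zero: "h \<in> hom_free V ds es \<Longrightarrow> h 0 = 0"
  using hom_free_add[of h V ds es 0 0] by simp

lemma hom_free_uminus: "h \<in> hom_free V ds es \<Longrightarrow> u \<in> vecs V ds \<Longrightarrow> h (- u) = - h u"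
proof -
  assume h: "h \<in> hom_free V ds es" and u: "u \<in> vecs V ds"
  have "h u + h (- u) = h (u + - u)"
    by (rule hom_free_add[OF h u vecs_uminus[OF u], symmetric])
  also have "\<dots> = 0"
    by (simp only: add.right_inverse hom_free_zero[OF h])
  finally show ?thesis
    by (metis minus_unique)
qed

lemma hom_free_diff:
  "h \<in> hom_free V ds es \<Longrightarrow> u \<in> vecs V ds \<Longrightarrow> w \<in> vecs V ds \<Longrightarrow> h (u - w) = h u - h w"
  by (simp only: diff_conv_add_uminus hom_free_add vecs_uminus hom_free_uminus)

lemma hom_free_comp:
  "g \<in> hom_free V ds es \<Longrightarrow> h \<in> hom_free V es fs \<Longrightarrow> (\<lambda>u. h (g u)) \<in> hom_free V ds fs"
  unfolding graded_hom_def by (auto simp: image_subset_iff Pi_iff)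

lemma hom_free_ident: "(\<lambda>u. u) \<in> hom_free V ds ds"
  by (rule hom_freeI) auto

lemma hom_free_null: "(\<lambda>u. 0) \<in> hom_free V ds es"
  by (rule hom_freeI) (auto simp: grade_free_iff)

lemma hom_free_plus:
  assumes "g \<in> hom_free V ds es" "h \<in> hom_free V ds es"
  shows "(\<lambda>u. g u + h u) \<in> hom_free V ds es"
proof (rule hom_freeI)
  fix d and u :: "nat \<Rightarrow> ('a, 'b) mpoly" assume "u \<in> grade (graded_free V ds) d"
  then show "g u + h u \<in> grade (graded_free V es) d"
    using hom_free_grade[OF assms(1)] hom_free_grade[OF assms(2)]
    by (auto simp: grade_free_iff intro: homogeneous_add)
qed (simp_all add: assms hom_free_vecs[OF assms(1)] hom_free_vecs[OF assms(2)] hom_free_add[OF assms(1)]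
  hom_free_add[OF assms(2)] hom_free_scale[OF assms(1)] hom_free_scale[OF assms(2)]
  vecs_add add_ac fun_eq_iff distrib_left)

lemma hom_free_neg:
  assumes "h \<in> hom_free V ds es"
  shows "(\<lambda>u. - h u) \<in> hom_free V ds es"
proof (rule hom_freeI)
  fix d and u :: "nat \<Rightarrow> ('a, 'b) mpoly" assume "u \<in> grade (graded_free V ds) d"
  then show "- h u \<in> grade (graded_free V es) d"
    using hom_free_grade[OF assms(1)]
    by (auto simp: grade_free_iff intro: homogeneous_uminus)
qed (simp_all add: hom_free_vecs[OF assms] hom_free_add[OF assms] hom_free_scale[OF assms]
  vecs_uminus fun_eq_iff)

lemma hom_free_minus:
  assumes "g \<in> hom_free V ds es" "h \<in> hom_free V ds es"
  shows "(\<lambda>u. g u - h u) \<in> hom_free V ds es"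
  using hom_free_plus[OF assms(1) hom_free_neg[OF assms(2)]] by (simp only: add_uminus_conv_diff)

lemma hom_free_mult:
  assumes "h \<in> hom_free V ds es" "a \<in> homogeneous V c"
  shows "(\<lambda>u. scale a (h u)) \<in> hom_free V (map ((+) c) ds) es"
proof (rule hom_freeI)
  have ds: "vecs V (map ((+) c) ds) = vecs V ds"
    by (auto simp: vecs_iff)
  fix u w :: "nat \<Rightarrow> ('a, 'b) mpoly" and b d assume u: "u \<in> vecs V (map ((+) c) ds)"
  then show "scale a (h u) \<in> vecs V es"
    using assms by (auto simp: ds intro: vecs_scale hom_free_vecs homogeneous_polys)
  show "scale a (h (scale b u)) = scale b (scale a (h u))" if "b \<in> polys V"
    using that u by (simp add: ds hom_free_scale[OF assms(1)] algebra_simps)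
  show "scale a (h (u + w)) = scale a (h u) + scale a (h w)" if "w \<in> vecs V (map ((+) c) ds)"
    using that u by (simp add: ds hom_free_add[OF assms(1)] algebra_simps fun_eq_iff)
next
  fix d and u :: "nat \<Rightarrow> ('a, 'b) mpoly" assume "u \<in> grade (graded_free V (map ((+) c) ds)) d"
  then have "u \<in> grade (graded_free V ds) (d - c)"
    by (simp add: grade_free_iff algebra_simps)
  then have "h u \<in> grade (graded_free V es) (d - c)"
    by (rule hom_free_grade[OF assms(1)])
  then show "scale a (h u) \<in> grade (graded_free V es) d"
    using homogeneous_mult[OF assms(2)] by (fastforce simp: grade_free_iff)
qed

lemma hom_free_shift:
  fixes V :: "'a set" and h :: "(nat \<Rightarrow> ('a, 'b::field) mpoly) \<Rightarrow> _"
  assumes "h \<in> hom_free V ds es"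
  shows "h \<in> hom_free V (map ((+) c) ds) (map ((+) c) es)"
proof -
  have "(vecs V (map ((+) c) ds) :: (nat \<Rightarrow> ('a, 'b) mpoly) set) = vecs V ds" for ds
    by (auto simp: vecs_iff)
  moreover have "grade (graded_free V (map ((+) c) ds)) d =
      (grade (graded_free V ds) (d - c) :: (nat \<Rightarrow> ('a, 'b) mpoly) set)" for ds d
    by (auto simp: grade_free_iff algebra_simps)
  ultimately show ?thesis
    using assms by (simp add: graded_hom_def)
qed

lemma vecs_shift [simp]: "vecs V (map ((+) c) ds) = vecs V ds"
  by (auto simp: vecs_iff)

lemma lin_ext_hom:
  assumes "\<And>k. k < length ds \<Longrightarrow> b k \<in> grade (graded_free V es) (ds ! k)"
  shows "lin_ext (length ds) b \<in> hom_free V ds es"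
proof (rule hom_freeI)
  have b: "b k \<in> vecs V es" if "k < length ds" for k
    using assms[OF that] by (rule grade_free_vecs)
  fix u w :: "nat \<Rightarrow> ('a, 'b) mpoly" and a assume u: "u \<in> vecs V ds"
  show "lin_ext (length ds) b u \<in> vecs V es"
    using u b by (auto simp: vecs_iff lin_ext_def intro!: polys_sum polys_mult)
next
  fix d and u :: "nat \<Rightarrow> ('a, 'b) mpoly" assume u: "u \<in> grade (graded_free V ds) d"
  show "lin_ext (length ds) b u \<in> grade (graded_free V es) d"
    unfolding grade_free_iff
  proof (intro conjI allI impI)
    fix l assume l: "l < length es"
    show "lin_ext (length ds) b u l \<in> homogeneous V (d - es ! l)"
      unfolding lin_ext_def
    proof (rule homogeneous_sum)
      fix k assume "k \<in> {..<length ds}"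
      then have "u k \<in> homogeneous V (d - ds ! k)" "b k l \<in> homogeneous V (ds ! k - es ! l)"
        using u assms[of k] l by (auto simp: grade_free_iff)
      from homogeneous_mult[OF this] show "u k * b k l \<in> homogeneous V (d - es ! l)"
        by simp
    qed
  next
    fix l assume "length es \<le> l"
    then show "lin_ext (length ds) b u l = 0"
      using assms by (auto simp: lin_ext_def grade_free_iff)
  qed
qed (auto simp: lin_ext_def algebra_simps sum.distrib sum_distrib_left fun_eq_iff)

lemma graded_hom_free_linear:
  assumes "h \<in> graded_hom V (graded_free V ds) M"
  shows "u \<in> vecs V ds \<Longrightarrow> h u \<in> carrier M"
    and "u \<in> vecs V ds \<Longrightarrow> w \<in> vecs V ds \<Longrightarrow> h (u + w) = h u \<oplus>\<^bsub>M\<^esub> h w"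
    and "a \<in> polys V \<Longrightarrow> u \<in> vecs V ds \<Longrightarrow> h (scale a u) = a \<odot>\<^bsub>M\<^esub> h u"
    and "u \<in> grade (graded_free V ds) d \<Longrightarrow> h u \<in> grade M d"
  using assms unfolding graded_hom_def by (simp_all add: Pi_iff image_subset_iff)

text \<open>Stated for an arbitrary target module because it is needed both for free modules and for the quotient
\<open>S/I\<close>.\<close>

lemma linear_eq_on_basis:
  assumes M: "module (poly_ring V) M"
    and h: "h \<in> graded_hom V (graded_free V ds) M" and h': "h' \<in> graded_hom V (graded_free V ds) M"
    and eq: "\<And>k. k < length ds \<Longrightarrow> h (basis_vec k) = h' (basis_vec k)"
    and u: "u \<in> vecs V ds"
  shows "h u = h' u"
proof -
  have "h u = h' u" if "j \<le> length ds" "u \<in> vecs V ds" "\<forall>k\<ge>j. u k = 0" for j u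
    using that
  proof (induction j arbitrary: u)
    case 0
    then have u0: "u = scale 0 u" by (auto simp: fun_eq_iff)
    have "f u = \<zero>\<^bsub>M\<^esub>" if f: "f \<in> graded_hom V (graded_free V ds) M" for f
    proof -
      have "f u = f (scale 0 u)" using u0 by (rule arg_cong)
      also have "\<dots> = 0 \<odot>\<^bsub>M\<^esub> f u"
        by (rule graded_hom_free_linear(3)[OF f polys_zero 0(2)])
      also have "\<dots> = \<zero>\<^bsub>M\<^esub>"
        using module.smult_l_null[OF M graded_hom_free_linear(1)[OF f 0(2)]] by simp
      finally show ?thesis .
    qed
    from this[OF h] this[OF h'] show ?case by (rule trans[OF _ sym])
  next
    case (Suc j)
    let ?w = "\<lambda>k. if k = j then 0 else u k"
    let ?e = "scale (u j) (basis_vec j)"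
    have w: "?w \<in> vecs V ds" and uj: "u j \<in> polys V"
      using Suc.prems by (auto simp: vecs_iff)
    have b: "basis_vec j \<in> vecs V ds"
      using Suc.prems by (intro basis_vec_vecs) auto
    have "h ?w = h' ?w"
      by (rule Suc.IH) (use Suc.prems w in \<open>auto simp: not_less_eq_eq le_Suc_eq\<close>)
    moreover have "h ?e = h' ?e"
      using graded_hom_free_linear(3)[OF h uj b] graded_hom_free_linear(3)[OF h' uj b]
        eq[of j] Suc.prems(1) by simp
    moreover have "u = ?w + ?e"
      by (auto simp: fun_eq_iff basis_vec_def)
    moreover note graded_hom_free_linear(2)[OF h w vecs_scale[OF uj b]]
      graded_hom_free_linear(2)[OF h' w vecs_scale[OF uj b]]
    ultimately show ?case by metis
  qed
  from this[of "length ds" u] u show ?thesis by (auto simp: vecs_iff)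
qed

lemma lin_ext_basis_vec:
  assumes k: "k < r"
  shows "lin_ext r b (basis_vec k) = b k"
proof (rule ext)
  fix l
  have "lin_ext r b (basis_vec k) l = (\<Sum>i<r. if i = k then b i l else 0)"
    unfolding lin_ext_def basis_vec_def by (rule sum.cong) simp_all
  also have "\<dots> = b k l"
    using k by (subst sum.delta) simp_all
  finally show "lin_ext r b (basis_vec k) l = b k l" .
qed

lemma hom_free_lin_ext:
  assumes "h \<in> hom_free V ds es" "u \<in> vecs V ds"
  shows "h u = lin_ext (length ds) (\<lambda>k. h (basis_vec k)) u"
proof -
  have "lin_ext (length ds) (\<lambda>k. h (basis_vec k)) \<in> hom_free V ds es"
    by (rule lin_ext_hom) (rule hom_free_grade[OF assms(1) basis_vec_grade])
  moreover have "h (basis_vec k) = lin_ext (length ds) (\<lambda>k. h (basis_vec k)) (basis_vec k)"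
    if "k < length ds" for k
    by (simp only: lin_ext_basis_vec[OF that])
  ultimately show ?thesis
    using linear_eq_on_basis[OF module_graded_free assms(1) _ _ assms(2)] by blast
qed

definition vcomp :: "int list \<Rightarrow> int \<Rightarrow> (nat \<Rightarrow> ('v, 'k::field) mpoly) \<Rightarrow> nat \<Rightarrow> ('v, 'k) mpoly" where
  "vcomp ds d u = (\<lambda>k. if k < length ds then hcomp (d - ds ! k) (u k) else 0)"

lemma vcomp_grade: "u \<in> vecs V ds \<Longrightarrow> vcomp ds d u \<in> grade (graded_free V ds) d"
  by (auto simp: grade_free_iff vcomp_def vecs_iff intro: hcomp_homogeneous)

lemma vcomp_id: "u \<in> grade (graded_free V ds) d \<Longrightarrow> vcomp ds d u = u"
  by (auto simp: grade_free_iff vcomp_def hcomp_id fun_eq_iff)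

lemma vcomp_diff: "vcomp ds d (u - w) = vcomp ds d u - vcomp ds d w"
  by (auto simp: vcomp_def fun_eq_iff hcomp_diff)

text \<open>A graded map is given by a matrix of homogeneous entries, hence it commutes with taking
homogeneous components.\<close>

lemma hom_free_vcomp:
  assumes h: "h \<in> hom_free V ds es" and u: "u \<in> vecs V ds"
  shows "h (vcomp ds d u) = vcomp es d (h u)"
proof
  fix l
  have v: "vcomp ds d u \<in> vecs V ds"
    using vcomp_grade[OF u] by (rule grade_free_vecs)
  have hv: "h (vcomp ds d u) \<in> vecs V es"
    by (rule hom_free_vecs[OF h v])
  show "h (vcomp ds d u) l = vcomp es d (h u) l"
  proof (cases "l < length es")
    case True
    have "hcomp (d - es ! l) (u k * h (basis_vec k) l) = vcomp ds d u k * h (basis_vec k) l"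
      if k: "k < length ds" for k
    proof -
      have "h (basis_vec k) l \<in> homogeneous V (ds ! k - es ! l)"
        using hom_free_grade[OF h basis_vec_grade[OF k]] True by (simp add: grade_free_iff)
      from hcomp_mult_homogeneous[OF _ this, of "u k" "d - es ! l"] show ?thesis
        using k vecs_polys[OF u] by (simp add: vcomp_def)
    qed
    then show ?thesis
      using True by (simp add: hom_free_lin_ext[OF h v] hom_free_lin_ext[OF h u])
        (simp add: lin_ext_def vcomp_def hcomp_sum)
  next
    case False
    then show ?thesis using hv by (simp add: vcomp_def vecs_iff)
  qed
qed

text \<open>Projectivity of graded free modules, relative to a graded submodule \<open>U\<close>.  A preimage of the image of a
basis vector can be replaced by its component of the right degree, because \<open>U\<close> contains the
components of its elements; this makes the lift graded.  Taking \<open>U = {0}\<close> gives the usual lifting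
property, and taking for \<open>U\<close> the ideal \<open>I\<close> gives lifts modulo \<open>I\<close>, which are needed in
homological degree zero.\<close>

lemma lift_through:
  assumes \<alpha>: "\<alpha> \<in> hom_free V ds es" and \<beta>: "\<beta> \<in> hom_free V as es"
    and U: "0 \<in> U" "\<And>u w. u \<in> U \<Longrightarrow> w \<in> U \<Longrightarrow> u + w \<in> U"
      "\<And>a u. a \<in> polys V \<Longrightarrow> u \<in> U \<Longrightarrow> scale a u \<in> U" "\<And>d u. u \<in> U \<Longrightarrow> vcomp es d u \<in> U"
    and sub: "\<And>u. u \<in> vecs V ds \<Longrightarrow> \<exists>a\<in>vecs V as. \<alpha> u - \<beta> a \<in> U"
  shows "\<exists>\<gamma>\<in>hom_free V ds as. \<forall>u\<in>vecs V ds. \<alpha> u - \<beta> (\<gamma> u) \<in> U"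
proof -
  have "\<exists>a. a \<in> grade (graded_free V as) (ds ! k) \<and> \<alpha> (basis_vec k) - \<beta> a \<in> U"
    if k: "k < length ds" for k
  proof -
    obtain a where a: "a \<in> vecs V as" "\<alpha> (basis_vec k) - \<beta> a \<in> U"
      using sub[OF basis_vec_vecs[OF k]] by blast
    have "vcomp es (ds ! k) (\<alpha> (basis_vec k) - \<beta> a) = \<alpha> (basis_vec k) - \<beta> (vcomp as (ds ! k) a)"
      by (simp only: vcomp_diff hom_free_vcomp[OF \<beta> a(1)]
          vcomp_id[OF hom_free_grade[OF \<alpha> basis_vec_grade[OF k]]])
    with U(4)[OF a(2), of "ds ! k"] have "\<alpha> (basis_vec k) - \<beta> (vcomp as (ds ! k) a) \<in> U"
      by (simp only:)
    with vcomp_grade[OF a(1)] show ?thesis by blast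
  qed
  then have "\<forall>k\<in>{..<length ds}. \<exists>a. a \<in> grade (graded_free V as) (ds ! k) \<and> \<alpha> (basis_vec k) - \<beta> a \<in> U"
    by blast
  from bchoice[OF this] obtain b where b: "\<And>k. k < length ds \<Longrightarrow> b k \<in> grade (graded_free V as) (ds ! k)"
      "\<And>k. k < length ds \<Longrightarrow> \<alpha> (basis_vec k) - \<beta> (b k) \<in> U"
    by blast
  let ?\<gamma> = "lin_ext (length ds) b"
  have \<gamma>: "?\<gamma> \<in> hom_free V ds as" by (rule lin_ext_hom) (rule b(1))
  have \<delta>: "(\<lambda>u. \<alpha> u - \<beta> (?\<gamma> u)) \<in> hom_free V ds es"
    by (intro hom_free_minus \<alpha> hom_free_comp[OF \<gamma> \<beta>])
  have "\<alpha> u - \<beta> (?\<gamma> u) \<in> U" if u: "u \<in> vecs V ds" for u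
  proof -
    let ?b = "\<lambda>k. \<alpha> (basis_vec k) - \<beta> (?\<gamma> (basis_vec k))"
    have "lin_ext j ?b u \<in> U" if "j \<le> length ds" for j
      using that
    proof (induction j)
      case 0
      then show ?case using U(1) by (simp add: lin_ext_def zero_fun_def)
    next
      case (Suc j)
      have "lin_ext (Suc j) ?b u = lin_ext j ?b u + scale (u j) (?b j)"
        by (simp add: lin_ext_def fun_eq_iff)
      moreover have "scale (u j) (?b j) \<in> U"
        using Suc.prems vecs_polys[OF u, of j] b(2)[of j] U(3)[of "u j" "\<alpha> (basis_vec j) - \<beta> (b j)"]
        by (simp add: lin_ext_basis_vec)
      moreover have "lin_ext j ?b u \<in> U" by (rule Suc.IH) (use Suc.prems in simp)
      ultimately show ?case using U(2) by (simp only:)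
    qed
    from this[OF order_refl] show ?thesis
      unfolding hom_free_lin_ext[OF \<delta> u] .
  qed
  then show ?thesis using \<gamma> by blast
qed

lemma lift_through_exact:
  assumes \<alpha>: "\<alpha> \<in> hom_free V ds es" and \<beta>: "\<beta> \<in> hom_free V as es"
    and sub: "\<And>u. u \<in> vecs V ds \<Longrightarrow> \<alpha> u \<in> \<beta> ` vecs V as"
  shows "\<exists>\<gamma>\<in>hom_free V ds as. \<forall>u\<in>vecs V ds. \<beta> (\<gamma> u) = \<alpha> u"
proof -
  have "\<exists>\<gamma>\<in>hom_free V ds as. \<forall>u\<in>vecs V ds. \<alpha> u - \<beta> (\<gamma> u) \<in> {0 :: nat \<Rightarrow> ('a, 'b) mpoly}"
  proof (rule lift_through[OF \<alpha> \<beta>])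
    fix u :: "nat \<Rightarrow> ('a, 'b) mpoly" assume "u \<in> vecs V ds"
    then obtain a where "a \<in> vecs V as" "\<alpha> u = \<beta> a" using sub by blast
    then have "\<alpha> u - \<beta> a \<in> {0}" by (simp only: diff_self singleton_iff)
    then show "\<exists>a\<in>vecs V as. \<alpha> u - \<beta> a \<in> {0}" using \<open>a \<in> vecs V as\<close> by blast
  next
    fix d and u :: "nat \<Rightarrow> ('a, 'b) mpoly" assume "u \<in> {0}"
    then show "vcomp es d u \<in> {0}" by (auto simp: vcomp_def fun_eq_iff)
  qed auto
  then obtain \<gamma> where \<gamma>: "\<gamma> \<in> hom_free V ds as"
    "\<forall>u\<in>vecs V ds. \<alpha> u - \<beta> (\<gamma> u) \<in> {0 :: nat \<Rightarrow> ('a, 'b) mpoly}"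
    by (rule bexE)
  have "\<beta> (\<gamma> u) = \<alpha> u" if "u \<in> vecs V ds" for u
  proof -
    have "\<alpha> u - \<beta> (\<gamma> u) = 0" using \<gamma>(2) that by (simp only: singleton_iff) 
    then show ?thesis by (simp only: right_minus_eq)
  qed
  then show ?thesis using \<gamma>(1) by blast
qed

section \<open>Comparison and uniqueness of minimal resolutions\<close>

text \<open>A minimal resolution of \<open>S/I\<close> in which the augmentation \<open>F\<^sub>0 \<rightarrow> S/I\<close> is replaced by a lift
\<open>e : F\<^sub>0 \<rightarrow> S\<close>, with \<open>S\<close> viewed as the free module of rank one.  All maps are then maps between free
modules, and cosets disappear from the homological algebra.\<close>

definition cyclic_min_res ::
    "'v set \<Rightarrow> ('v, 'k::field) mpoly set \<Rightarrow> (nat \<Rightarrow> int list)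
     \<Rightarrow> (nat \<Rightarrow> (nat \<Rightarrow> ('v, 'k) mpoly) \<Rightarrow> (nat \<Rightarrow> ('v, 'k) mpoly))
     \<Rightarrow> ((nat \<Rightarrow> ('v, 'k) mpoly) \<Rightarrow> (nat \<Rightarrow> ('v, 'k) mpoly)) \<Rightarrow> bool" where
  "cyclic_min_res V I ds \<phi> e \<longleftrightarrow>
    e \<in> hom_free V (ds 0) [0] \<and> (\<forall>i. \<phi> i \<in> hom_free V (ds (Suc i)) (ds i)) \<and>
    (\<forall>s\<in>polys V. \<exists>u\<in>vecs V (ds 0). s - e u 0 \<in> I) \<and>
    \<phi> 0 ` vecs V (ds (Suc 0)) = {u \<in> vecs V (ds 0). e u 0 \<in> I} \<and>
    (\<forall>i. \<phi> (Suc i) ` vecs V (ds (Suc (Suc i))) = {u \<in> vecs V (ds (Suc i)). \<phi> i u = 0}) \<and>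
    (\<forall>i. \<forall>u\<in>vecs V (ds (Suc i)). \<forall>k<length (ds i). \<phi> i u k \<in> irrelevant_ideal V)"

lemma cyclic_min_resD:
  assumes "cyclic_min_res V I ds \<phi> e"
  shows "e \<in> hom_free V (ds 0) [0]" "\<phi> i \<in> hom_free V (ds (Suc i)) (ds i)"
    "s \<in> polys V \<Longrightarrow> \<exists>u\<in>vecs V (ds 0). s - e u 0 \<in> I"
    "\<phi> 0 ` vecs V (ds (Suc 0)) = {u \<in> vecs V (ds 0). e u 0 \<in> I}"
    "\<phi> (Suc i) ` vecs V (ds (Suc (Suc i))) = {u \<in> vecs V (ds (Suc i)). \<phi> i u = 0}"
    "u \<in> vecs V (ds (Suc i)) \<Longrightarrow> k < length (ds i) \<Longrightarrow> \<phi> i u k \<in> irrelevant_ideal V"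
proof -
  note r = assms[unfolded cyclic_min_res_def]
  show "e \<in> hom_free V (ds 0) [0]"
    by (rule r[THEN conjunct1])
  show "\<phi> i \<in> hom_free V (ds (Suc i)) (ds i)"
    by (rule r[THEN conjunct2, THEN conjunct1, rule_format])
  show "s \<in> polys V \<Longrightarrow> \<exists>u\<in>vecs V (ds 0). s - e u 0 \<in> I"
    by (rule r[THEN conjunct2, THEN conjunct2, THEN conjunct1, rule_format])
  show "\<phi> 0 ` vecs V (ds (Suc 0)) = {u \<in> vecs V (ds 0). e u 0 \<in> I}"
    by (rule r[THEN conjunct2, THEN conjunct2, THEN conjunct2, THEN conjunct1])
  show "\<phi> (Suc i) ` vecs V (ds (Suc (Suc i))) = {u \<in> vecs V (ds (Suc i)). \<phi> i u = 0}"
    by (rule r[THEN conjunct2, THEN conjunct2, THEN conjunct2, THEN conjunct2, THEN conjunct1, THEN spec])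
  show "u \<in> vecs V (ds (Suc i)) \<Longrightarrow> k < length (ds i) \<Longrightarrow> \<phi> i u k \<in> irrelevant_ideal V"
    by (rule r[THEN conjunct2, THEN conjunct2, THEN conjunct2, THEN conjunct2, THEN conjunct2, rule_format])
qed

lemma cyclic_min_res_complex:
  assumes "cyclic_min_res V I ds \<phi> e" "u \<in> vecs V (ds (Suc (Suc i)))"
  shows "\<phi> i (\<phi> (Suc i) u) = 0"
proof -
  have "\<phi> (Suc i) u \<in> \<phi> (Suc i) ` vecs V (ds (Suc (Suc i)))"
    using assms(2) by (rule imageI)
  then show ?thesis
    unfolding cyclic_min_resD(5)[OF assms(1)] by simp
qed

text \<open>The usual comparison theorem: each square is filled by lifting through the exact lower row.\<close>

lemma extend_chain_map:
  assumes \<phi>: "\<And>i. \<phi> i \<in> hom_free V (ds (Suc i)) (ds i)"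
    and \<phi>': "\<And>i. \<phi>' i \<in> hom_free V (es (Suc i)) (es i)"
    and cx: "\<And>i u. u \<in> vecs V (ds (Suc (Suc i))) \<Longrightarrow> \<phi> i (\<phi> (Suc i) u) = 0"
    and ex: "\<And>i w. w \<in> vecs V (es (Suc i)) \<Longrightarrow> \<phi>' i w = 0 \<Longrightarrow> w \<in> \<phi>' (Suc i) ` vecs V (es (Suc (Suc i)))"
    and g0: "g0 \<in> hom_free V (ds 0) (es 0)"
    and im: "\<And>u. u \<in> vecs V (ds (Suc 0)) \<Longrightarrow> g0 (\<phi> 0 u) \<in> \<phi>' 0 ` vecs V (es (Suc 0))"
  shows "\<exists>g. g 0 = g0 \<and> (\<forall>i. g i \<in> hom_free V (ds i) (es i)) \<and>
    (\<forall>i. \<forall>u\<in>vecs V (ds (Suc i)). \<phi>' i (g (Suc i) u) = g i (\<phi> i u))"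
proof -
  define P where "P n h \<longleftrightarrow> h \<in> hom_free V (ds n) (es n) \<and>
    (\<forall>u\<in>vecs V (ds (Suc n)). h (\<phi> n u) \<in> \<phi>' n ` vecs V (es (Suc n))) \<and> (n = 0 \<longrightarrow> h = g0)" for n h
  define Q where "Q n h h' \<longleftrightarrow> (\<forall>u\<in>vecs V (ds (Suc n)). \<phi>' n (h' u) = h (\<phi> n u))" for n h h'
  have "\<exists>g. \<forall>n. P n (g n) \<and> Q n (g n) (g (Suc n))"
  proof (rule dependent_nat_choice)
    show "\<exists>h. P 0 h" using g0 im by (auto simp: P_def)
  next
    fix h n assume h: "P n h"
    then have hh: "h \<in> hom_free V (ds n) (es n)" by (simp add: P_def)
    have "h (\<phi> n u) \<in> \<phi>' n ` vecs V (es (Suc n))" if "u \<in> vecs V (ds (Suc n))" for u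
      using h that by (simp add: P_def)
    from lift_through_exact[OF hom_free_comp[OF \<phi>[of n] hh] \<phi>'[of n] this]
    obtain h' where h': "h' \<in> hom_free V (ds (Suc n)) (es (Suc n))"
      "\<forall>u\<in>vecs V (ds (Suc n)). \<phi>' n (h' u) = h (\<phi> n u)"
      by (rule bexE)
    have "h' (\<phi> (Suc n) u) \<in> \<phi>' (Suc n) ` vecs V (es (Suc (Suc n)))"
      if u: "u \<in> vecs V (ds (Suc (Suc n)))" for u
    proof (rule ex)
      have pu: "\<phi> (Suc n) u \<in> vecs V (ds (Suc n))" by (rule hom_free_vecs[OF \<phi> u])
      then show "h' (\<phi> (Suc n) u) \<in> vecs V (es (Suc n))" by (rule hom_free_vecs[OF h'(1)])
      show "\<phi>' n (h' (\<phi> (Suc n) u)) = 0"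
        by (simp only: h'(2)[rule_format, OF pu] cx[OF u] hom_free_zero[OF hh])
    qed
    then have "P (Suc n) h'" "Q n h h'" using h' by (simp_all add: P_def Q_def)
    then show "\<exists>h'. P (Suc n) h' \<and> Q n h h'" by blast
  qed
  then obtain g where "\<And>n. P n (g n)" "\<And>n. Q n (g n) (g (Suc n))" by blast
  then show ?thesis by (intro exI[of _ g]) (simp add: P_def Q_def)
qed

definition hcomp_closed :: "('v, 'k::field) mpoly set \<Rightarrow> bool" where
  "hcomp_closed I \<longleftrightarrow> (\<forall>d. \<forall>f\<in>I. hcomp d f \<in> I)"

text \<open>In degree zero the lift only agrees with the augmentation modulo \<open>I\<close>; this suffices because the
image of the first differential consists of all vectors whose augmentation lies in \<open>I\<close>.\<close>

lemma comparison_map: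
  fixes I :: "('v, 'k::field) mpoly set"
  assumes I: "ideal I (poly_ring V)" "hcomp_closed I"
    and F: "cyclic_min_res V I ds \<phi> e" and G: "cyclic_min_res V I es \<phi>' e'"
  shows "\<exists>f. (\<forall>i. f i \<in> hom_free V (ds i) (es i)) \<and>
    (\<forall>u\<in>vecs V (ds 0). e u 0 - e' (f 0 u) 0 \<in> I) \<and>
    (\<forall>i. \<forall>u\<in>vecs V (ds (Suc i)). \<phi>' i (f (Suc i) u) = f i (\<phi> i u))"
proof -
  note Ip = ideal_props[OF I(1)]
  let ?U = "{u :: nat \<Rightarrow> ('v, 'k) mpoly. u 0 \<in> I}"
  have "\<exists>\<gamma>\<in>hom_free V (ds 0) (es 0). \<forall>u\<in>vecs V (ds 0). e u - e' (\<gamma> u) \<in> ?U"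
  proof (rule lift_through[OF cyclic_min_resD(1)[OF F] cyclic_min_resD(1)[OF G]])
    fix u :: "nat \<Rightarrow> ('v, 'k) mpoly" assume "u \<in> vecs V (ds 0)"
    then have "e u 0 \<in> polys V"
      by (intro vecs_polys[OF hom_free_vecs[OF cyclic_min_resD(1)[OF F]]])
    from cyclic_min_resD(3)[OF G this]
    show "\<exists>a\<in>vecs V (es 0). e u - e' a \<in> ?U" by simp
  qed (use Ip I(2) in \<open>auto simp: vcomp_def hcomp_closed_def\<close>)
  then obtain f0 where f0: "f0 \<in> hom_free V (ds 0) (es 0)"
    and f0': "\<forall>u\<in>vecs V (ds 0). e u - e' (f0 u) \<in> ?U"
    by (rule bexE)
  have f0I: "e u 0 - e' (f0 u) 0 \<in> I" if "u \<in> vecs V (ds 0)" for u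
    using f0'[rule_format, OF that] by simp
  have im: "f0 (\<phi> 0 u) \<in> \<phi>' 0 ` vecs V (es (Suc 0))" if u: "u \<in> vecs V (ds (Suc 0))" for u
  proof -
    have "\<phi> 0 u \<in> \<phi> 0 ` vecs V (ds (Suc 0))" using u by (rule imageI)
    then have pu: "\<phi> 0 u \<in> vecs V (ds 0)" "e (\<phi> 0 u) 0 \<in> I"
      unfolding cyclic_min_resD(4)[OF F] by simp_all
    have "e (\<phi> 0 u) 0 - (e (\<phi> 0 u) 0 - e' (f0 (\<phi> 0 u)) 0) \<in> I"
      by (rule Ip(6)[OF pu(2) f0I[OF pu(1)]])
    then have "e' (f0 (\<phi> 0 u)) 0 \<in> I" by simp
    with hom_free_vecs[OF f0 pu(1)] show ?thesis
      unfolding cyclic_min_resD(4)[OF G] by simp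
  qed
  have ex: "w \<in> \<phi>' (Suc i) ` vecs V (es (Suc (Suc i)))" if "w \<in> vecs V (es (Suc i))" "\<phi>' i w = 0" for i w
    unfolding cyclic_min_resD(5)[OF G] using that by simp
  have "\<exists>f. f 0 = f0 \<and> (\<forall>i. f i \<in> hom_free V (ds i) (es i)) \<and>
    (\<forall>i. \<forall>u\<in>vecs V (ds (Suc i)). \<phi>' i (f (Suc i) u) = f i (\<phi> i u))"
    by (rule extend_chain_map[OF cyclic_min_resD(2)[OF F] cyclic_min_resD(2)[OF G]
      cyclic_min_res_complex[OF F] ex f0 im])
  then show ?thesis by (elim ex_forward conjE) (simp add: f0I)
qed

lemma homotopy_to_identity:
  fixes I :: "('v, 'k::field) mpoly set"
  assumes F: "cyclic_min_res V I ds \<phi> e"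
    and c: "\<And>i. c i \<in> hom_free V (ds i) (ds i)"
    and c0: "\<And>u. u \<in> vecs V (ds 0) \<Longrightarrow> e (c 0 u) 0 - e u 0 \<in> I"
    and cc: "\<And>i u. u \<in> vecs V (ds (Suc i)) \<Longrightarrow> \<phi> i (c (Suc i) u) = c i (\<phi> i u)"
  shows "\<exists>h. (\<forall>i. h i \<in> hom_free V (ds i) (ds (Suc i))) \<and>
    (\<forall>u\<in>vecs V (ds 0). \<phi> 0 (h 0 u) = c 0 u - u) \<and>
    (\<forall>i. \<forall>u\<in>vecs V (ds (Suc i)). \<phi> (Suc i) (h (Suc i) u) = c (Suc i) u - u - h i (\<phi> i u))"
proof -
  note \<phi> = cyclic_min_resD(2)[OF F]
  \<comment> \<open>The second clause of \<open>P\<close> is what makes the obstruction to the next homotopy a cycle.\<close>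
  define P where "P n h \<longleftrightarrow> h \<in> hom_free V (ds n) (ds (Suc n)) \<and>
    (\<forall>u\<in>vecs V (ds (Suc n)). \<phi> n (h (\<phi> n u)) = c n (\<phi> n u) - \<phi> n u) \<and>
    (n = 0 \<longrightarrow> (\<forall>u\<in>vecs V (ds 0). \<phi> 0 (h u) = c 0 u - u))" for n h
  define Q where "Q n h h' \<longleftrightarrow>
    (\<forall>u\<in>vecs V (ds (Suc n)). \<phi> (Suc n) (h' u) = c (Suc n) u - u - h (\<phi> n u))" for n h h'
  have "\<exists>h. \<forall>n. P n (h n) \<and> Q n (h n) (h (Suc n))"
  proof (rule dependent_nat_choice)
    have "c 0 u - u \<in> \<phi> 0 ` vecs V (ds (Suc 0))" if u: "u \<in> vecs V (ds 0)" for u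
    proof -
      have cu: "c 0 u \<in> vecs V (ds 0)" by (rule hom_free_vecs[OF c u])
      have "e (c 0 u - u) 0 \<in> I"
        using c0[OF u] by (simp add: hom_free_diff[OF cyclic_min_resD(1)[OF F] cu u])
      then show ?thesis
        unfolding cyclic_min_resD(4)[OF F] using vecs_diff[OF cu u] by (simp only: mem_Collect_eq)
    qed
    from lift_through_exact[OF hom_free_minus[OF c[of 0] hom_free_ident] \<phi>[of 0] this]
    obtain h where h: "h \<in> hom_free V (ds 0) (ds (Suc 0))"
      "\<forall>u\<in>vecs V (ds 0). \<phi> 0 (h u) = c 0 u - u"
      by (rule bexE)
    moreover have "\<forall>u\<in>vecs V (ds (Suc 0)). \<phi> 0 (h (\<phi> 0 u)) = c 0 (\<phi> 0 u) - \<phi> 0 u"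
      by (intro ballI h(2)[rule_format] hom_free_vecs[OF \<phi>[of 0]])
    ultimately have "P 0 h" unfolding P_def by (simp only: simp_thms)
    then show "\<exists>h. P 0 h" by blast
  next
    fix h n assume h: "P n h"
    then have hh: "h \<in> hom_free V (ds n) (ds (Suc n))"
      and hc: "\<And>u. u \<in> vecs V (ds (Suc n)) \<Longrightarrow> \<phi> n (h (\<phi> n u)) = c n (\<phi> n u) - \<phi> n u"
      by (simp_all only: P_def)
    let ?\<alpha> = "\<lambda>u. c (Suc n) u - u - h (\<phi> n u)"
    have \<alpha>: "?\<alpha> \<in> hom_free V (ds (Suc n)) (ds (Suc n))"
      by (intro hom_free_minus c hom_free_ident hom_free_comp[OF \<phi> hh])
    have "?\<alpha> u \<in> \<phi> (Suc n) ` vecs V (ds (Suc (Suc n)))" if u: "u \<in> vecs V (ds (Suc n))" for u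
    proof -
      have v: "c (Suc n) u \<in> vecs V (ds (Suc n))" "h (\<phi> n u) \<in> vecs V (ds (Suc n))"
        by (intro hom_free_vecs[OF c] hom_free_vecs[OF hh] hom_free_vecs[OF \<phi>] u)+
      have "\<phi> n (?\<alpha> u) = \<phi> n (c (Suc n) u) - \<phi> n u - \<phi> n (h (\<phi> n u))"
        by (simp only: hom_free_diff[OF \<phi>] vecs_diff v u)
      also have "\<dots> = 0" by (simp only: cc[OF u] hc[OF u] diff_self)
      finally show ?thesis
        unfolding cyclic_min_resD(5)[OF F] using hom_free_vecs[OF \<alpha> u] by (simp only: mem_Collect_eq)
    qed
    from lift_through_exact[OF \<alpha> \<phi>[of "Suc n"] this]
    obtain h' where h': "h' \<in> hom_free V (ds (Suc n)) (ds (Suc (Suc n)))"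
      "\<forall>u\<in>vecs V (ds (Suc n)). \<phi> (Suc n) (h' u) = ?\<alpha> u"
      by (rule bexE)
    have nu: "\<phi> (Suc n) (h' (\<phi> (Suc n) u)) = c (Suc n) (\<phi> (Suc n) u) - \<phi> (Suc n) u"
      if u: "u \<in> vecs V (ds (Suc (Suc n)))" for u
      using h'(2)[rule_format, OF hom_free_vecs[OF \<phi> u]]
      by (simp only: cyclic_min_res_complex[OF F u] hom_free_zero[OF hh] diff_zero)
    have "P (Suc n) h'"
      unfolding P_def by (intro conjI ballI h'(1) nu) simp_all
    moreover have "Q n h h'" unfolding Q_def by (rule h'(2))
    ultimately show "\<exists>h'. P (Suc n) h' \<and> Q n h h'" by (intro exI conjI)
  qed
  then obtain h where h: "\<forall>n. P n (h n) \<and> Q n (h n) (h (Suc n))" by (rule exE)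
  show ?thesis
  proof (intro exI[of _ h] conjI allI ballI)
    show "h i \<in> hom_free V (ds i) (ds (Suc i))" for i
      using h[THEN spec, of i] by (simp only: P_def)
    show "\<phi> 0 (h 0 u) = c 0 u - u" if "u \<in> vecs V (ds 0)" for u
      using h[THEN spec, of 0] that by (simp only: P_def simp_thms)
    show "\<phi> (Suc i) (h (Suc i) u) = c (Suc i) u - u - h i (\<phi> i u)" if "u \<in> vecs V (ds (Suc i))" for i u
      using h[THEN spec, of i] that by (simp only: Q_def)
  qed
qed

text \<open>The difference to the identity is \<open>\<phi> h + h \<phi>\<close> for a homotopy \<open>h\<close>, and all entries of \<open>\<phi>\<close> lie in
the irrelevant ideal.\<close>

lemma self_map_congruent_identity:
  fixes I :: "('v, 'k::field) mpoly set"
  assumes F: "cyclic_min_res V I ds \<phi> e"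
    and c: "\<And>i. c i \<in> hom_free V (ds i) (ds i)"
    and c0: "\<And>u. u \<in> vecs V (ds 0) \<Longrightarrow> e (c 0 u) 0 - e u 0 \<in> I"
    and cc: "\<And>i u. u \<in> vecs V (ds (Suc i)) \<Longrightarrow> \<phi> i (c (Suc i) u) = c i (\<phi> i u)"
    and u: "u \<in> vecs V (ds i)" and k: "k < length (ds i)"
  shows "0 \<notin> Poly_Mapping.keys (c i u k - u k)"
proof -
  have "\<exists>h. (\<forall>i. h i \<in> hom_free V (ds i) (ds (Suc i))) \<and>
    (\<forall>u\<in>vecs V (ds 0). \<phi> 0 (h 0 u) = c 0 u - u) \<and>
    (\<forall>i. \<forall>u\<in>vecs V (ds (Suc i)). \<phi> (Suc i) (h (Suc i) u) = c (Suc i) u - u - h i (\<phi> i u))"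
    by (rule homotopy_to_identity[where c = c, OF F]) (rule c, erule c0, erule cc)
  then obtain h where hh: "(\<forall>i. h i \<in> hom_free V (ds i) (ds (Suc i))) \<and>
    (\<forall>u\<in>vecs V (ds 0). \<phi> 0 (h 0 u) = c 0 u - u) \<and>
    (\<forall>i. \<forall>u\<in>vecs V (ds (Suc i)). \<phi> (Suc i) (h (Suc i) u) = c (Suc i) u - u - h i (\<phi> i u))"
    by (rule exE)
  note h = hh[THEN conjunct1, rule_format] and h0 = hh[THEN conjunct2, THEN conjunct1, rule_format]
    and hS = hh[THEN conjunct2, THEN conjunct2, rule_format]
  note min = irrelevant_ideal_no_constant_term[OF cyclic_min_resD(6)[OF F]]
  have nc: "0 \<notin> Poly_Mapping.keys (\<phi> i (h i u) k)"
    by (rule min[OF hom_free_vecs[OF h u] k])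
  show ?thesis
  proof (cases i)
    case 0
    have "\<phi> i (h i u) = c i u - u"
      unfolding 0 by (rule h0) (use u 0 in simp)
    then have "\<phi> i (h i u) k = c i u k - u k"
      by (simp only: minus_apply)
    with nc show ?thesis by (simp only: not_False_eq_True)
  next
    case (Suc i')
    have w: "\<phi> i' u \<in> vecs V (ds i')"
      using u unfolding Suc by (rule hom_free_vecs[OF cyclic_min_resD(2)[OF F]])
    have eq: "h i' (\<phi> i' u) k = (\<Sum>q<length (ds i'). \<phi> i' u q * h i' (basis_vec q) k)"
      by (subst hom_free_lin_ext[OF h w]) (simp only: lin_ext_def)
    have "0 \<notin> Poly_Mapping.keys (\<Sum>q<length (ds i'). \<phi> i' u q * h i' (basis_vec q) k)"
      using u unfolding Suc by (intro no_constant_term_sum no_constant_term_mult min) (assumption, simp)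
    then have "0 \<notin> Poly_Mapping.keys (h i' (\<phi> i' u) k)"
      unfolding eq .
    moreover have "\<phi> i (h i u) = c i u - u - h i' (\<phi> i' u)"
      unfolding Suc by (rule hS) (use u Suc in simp)
    then have "\<phi> i (h i u) k = c i u k - u k - h i' (\<phi> i' u) k"
      by (simp only: minus_apply)
    ultimately show ?thesis
      using nc by (simp add: in_keys_iff lookup_minus)
  qed
qed

text \<open>If no generator of the second resolution has degree \<open>j\<close>, all entries in the column of a degree \<open>j\<close> basis
vector under the comparison map have nonzero degree and hence no constant term.  The round trip then has
no constant term on the diagonal either, although it is congruent to the identity.\<close>

lemma shifts_unique:
  fixes I :: "('v, 'k::field) mpoly set"
  assumes I: "ideal I (poly_ring V)" "hcomp_closed I"
    and F: "cyclic_min_res V I ds \<phi> e" and G: "cyclic_min_res V I es \<phi>' e'"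
  shows "set (ds i) \<subseteq> set (es i)"
proof
  fix j assume "j \<in> set (ds i)"
  then obtain k where k: "k < length (ds i)" "ds i ! k = j" by (auto simp: in_set_conv_nth)
  from comparison_map[OF I F G]
  obtain f where "\<forall>i. f i \<in> hom_free V (ds i) (es i)"
    and "\<forall>u\<in>vecs V (ds 0). e u 0 - e' (f 0 u) 0 \<in> I"
    and "\<forall>i. \<forall>u\<in>vecs V (ds (Suc i)). \<phi>' i (f (Suc i) u) = f i (\<phi> i u)"
    by (elim exE conjE)
  note f = this(1)[rule_format] and f0 = this(2)[rule_format] and fS = this(3)[rule_format]
  from comparison_map[OF I G F]
  obtain g where "\<forall>i. g i \<in> hom_free V (es i) (ds i)"
    and "\<forall>u\<in>vecs V (es 0). e' u 0 - e (g 0 u) 0 \<in> I"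
    and "\<forall>i. \<forall>u\<in>vecs V (es (Suc i)). \<phi> i (g (Suc i) u) = g i (\<phi>' i u)"
    by (elim exE conjE)
  note g = this(1)[rule_format] and g0 = this(2)[rule_format] and gS = this(3)[rule_format]
  let ?c = "\<lambda>i u. g i (f i u)"
  have c: "?c i \<in> hom_free V (ds i) (ds i)" for i
    by (rule hom_free_comp[OF f g])
  have c0: "e (?c 0 u) 0 - e u 0 \<in> I" if u: "u \<in> vecs V (ds 0)" for u
  proof -
    have "(e u 0 - e' (f 0 u) 0) + (e' (f 0 u) 0 - e (g 0 (f 0 u)) 0) \<in> I"
      by (rule ideal_props(3)[OF I(1) f0[OF u] g0[OF hom_free_vecs[OF f u]]])
    from ideal_props(5)[OF I(1) this] show ?thesis by simp
  qed
  have cc: "\<phi> i (?c (Suc i) u) = ?c i (\<phi> i u)" if u: "u \<in> vecs V (ds (Suc i))" for i u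
    by (simp only: gS[OF hom_free_vecs[OF f u]] fS[OF u])
  let ?b = "basis_vec k :: nat \<Rightarrow> ('v, 'k) mpoly"
  have b: "?b \<in> vecs V (ds i)" by (rule basis_vec_vecs[OF k(1)])
  have 1: "0 \<notin> Poly_Mapping.keys (?c i ?b k - ?b k)"
    by (rule self_map_congruent_identity[where c = ?c, OF F _ _ _ b k(1)]) (rule c, erule c0, erule cc)
  show "j \<in> set (es i)"
  proof (rule ccontr)
    assume j: "j \<notin> set (es i)"
    have fb: "f i ?b \<in> vecs V (es i)" by (rule hom_free_vecs[OF f b])
    have eq: "?c i ?b k = (\<Sum>q<length (es i). f i ?b q * g i (basis_vec q) k)"
      by (subst hom_free_lin_ext[OF g fb]) (simp only: lin_ext_def)
    have "0 \<notin> Poly_Mapping.keys (\<Sum>q<length (es i). f i ?b q * g i (basis_vec q) k)"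
    proof (intro no_constant_term_sum no_constant_term_mult)
      fix q assume q: "q \<in> {..<length (es i)}"
      then have "f i ?b q \<in> homogeneous V (j - es i ! q)"
        using hom_free_grade[OF f basis_vec_grade[OF k(1)]] k(2) by (auto simp: grade_free_iff)
      moreover have "j \<noteq> es i ! q" using j q by auto
      ultimately show "0 \<notin> Poly_Mapping.keys (f i ?b q)" by (auto simp: homogeneous_iff)
    qed
    then have "Poly_Mapping.lookup (?c i ?b k) 0 = 0"
      unfolding eq by (simp add: in_keys_iff)
    with 1 show False by (simp add: basis_vec_def in_keys_iff lookup_minus)
  qed
qed

section \<open>Regularity of cyclic modules\<close>

abbreviation residue :: "'v set \<Rightarrow> ('v, 'k::field) mpoly set \<Rightarrow> ('v, 'k) mpoly \<Rightarrow> ('v, 'k) mpoly set" where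
  "residue V I f \<equiv> I +>\<^bsub>poly_ring V\<^esub> f"

lemma residue_eq_iff:
  assumes "ideal I (poly_ring V)"
  shows "residue V I f = residue V I g \<longleftrightarrow> f - g \<in> I"
proof -
  note Ip = ideal_props[OF assms]
  have mem: "h \<in> residue V I f \<longleftrightarrow> h - f \<in> I" for h f
    by (auto simp: a_r_coset_def' algebra_simps intro: bexI[of _ "h - f"])
  show ?thesis
  proof
    assume "residue V I f = residue V I g"
    moreover have "f \<in> residue V I f" using Ip(2) by (simp add: mem)
    ultimately show "f - g \<in> I" by (simp add: mem)
  next
    assume fg: "f - g \<in> I"
    show "residue V I f = residue V I g"
    proof (intro Set.set_eqI)
      fix h
      have "h - f \<in> I \<Longrightarrow> h - g \<in> I" using Ip(3)[OF _ fg, of "h - f"] by simp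
      moreover have "h - g \<in> I \<Longrightarrow> h - f \<in> I" using Ip(6)[OF _ fg, of "h - g"] by simp
      ultimately show "h \<in> residue V I f \<longleftrightarrow> h \<in> residue V I g" by (auto simp: mem)
    qed
  qed
qed

lemma quotient_module_sel:
  assumes "ideal I (poly_ring V)"
  shows "carrier (quotient_module V I) = residue V I ` polys V"
    and "f \<in> polys V \<Longrightarrow> g \<in> polys V \<Longrightarrow>
      residue V I f \<oplus>\<^bsub>quotient_module V I\<^esub> residue V I g = residue V I (f + g)"
    and "a \<in> polys V \<Longrightarrow> f \<in> polys V \<Longrightarrow>
      a \<odot>\<^bsub>quotient_module V I\<^esub> residue V I f = residue V I (a * f)"
    and "\<zero>\<^bsub>quotient_module V I\<^esub> = residue V I 0"
    and "grade (quotient_module V I) d = residue V I ` homogeneous V d"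
proof -
  interpret ideal I "poly_ring V" by fact
  show "carrier (quotient_module V I) = residue V I ` polys V"
    by (auto simp: quotient_module_def Let_def FactRing_def A_RCOSETS_def')
  show "f \<in> polys V \<Longrightarrow> g \<in> polys V \<Longrightarrow>
      residue V I f \<oplus>\<^bsub>quotient_module V I\<^esub> residue V I g = residue V I (f + g)"
    using a_rcos_sum[of f g] by (simp add: quotient_module_def Let_def FactRing_def)
  show "a \<in> polys V \<Longrightarrow> f \<in> polys V \<Longrightarrow>
      a \<odot>\<^bsub>quotient_module V I\<^esub> residue V I f = residue V I (a * f)"
    using rcoset_mult_add[of a f] by (simp add: quotient_module_def Let_def FactRing_def)
  have "residue V I 0 = I" by (simp add: a_r_coset_def')
  then show "\<zero>\<^bsub>quotient_module V I\<^esub> = residue V I 0"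
    by (simp add: quotient_module_def Let_def FactRing_def)
  show "grade (quotient_module V I) d = residue V I ` homogeneous V d"
    by (auto simp: quotient_module_def Let_def)
qed

lemma residue_comp_hom:
  assumes I: "ideal I (poly_ring V)" and e: "e \<in> hom_free V ds [0]"
  shows "(\<lambda>u. residue V I (e u 0)) \<in> graded_hom V (graded_free V ds) (quotient_module V I)"
proof -
  note Q = quotient_module_sel[OF I]
  have ep: "e u 0 \<in> polys V" if "u \<in> vecs V ds" for u
    by (rule vecs_polys[OF hom_free_vecs[OF e that]])
  show ?thesis
    unfolding graded_hom_def
  proof (intro CollectI conjI ballI allI funcsetI subsetI)
    fix d y assume "y \<in> (\<lambda>u. residue V I (e u 0)) ` grade (graded_free V ds) d"
    then obtain u where u: "u \<in> grade (graded_free V ds) d" "y = residue V I (e u 0)" by (rule imageE)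
    then show "y \<in> grade (quotient_module V I) d"
      using hom_free_grade[OF e u(1)] by (simp add: Q grade_free_iff)
  qed (simp_all add: Q ep hom_free_add[OF e] hom_free_scale[OF e])
qed

lemma minimal_resolution_of_cyclic:
  fixes I :: "('v, 'k::field) mpoly set"
  assumes I: "ideal I (poly_ring V)" and F: "cyclic_min_res V I ds \<phi> e"
  shows "minimal_graded_free_resolution V (quotient_module V I) ds \<phi> (\<lambda>u. residue V I (e u 0))"
proof -
  note Q = quotient_module_sel[OF I] and e = cyclic_min_resD(1)[OF F]
  let ?\<epsilon> = "\<lambda>u. residue V I (e u 0)"
  have ep: "e u 0 \<in> polys V" if "u \<in> vecs V (ds 0)" for u
    by (rule vecs_polys[OF hom_free_vecs[OF e that]])
  have "?\<epsilon> ` vecs V (ds 0) = carrier (quotient_module V I)"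
    unfolding Q(1)
  proof (intro equalityI subsetI)
    fix y assume "y \<in> residue V I ` polys V"
    then obtain s where s: "s \<in> polys V" "y = residue V I s" by auto
    from cyclic_min_resD(3)[OF F s(1)] obtain u where "u \<in> vecs V (ds 0)" "s - e u 0 \<in> I"
      by (rule bexE)
    then show "y \<in> ?\<epsilon> ` vecs V (ds 0)"
      using residue_eq_iff[OF I] s(2) by (intro image_eqI[of _ _ u]) simp_all
  qed (use ep in auto)
  moreover have "a_kernel (graded_free V (ds 0)) (quotient_module V I) ?\<epsilon> = {u \<in> vecs V (ds 0). e u 0 \<in> I}"
    unfolding a_kernel_def' Q(4) residue_eq_iff[OF I] by simp
  moreover have "a_kernel (graded_free V (ds (Suc i))) (graded_free V (ds i)) (\<phi> i) =
      {u \<in> vecs V (ds (Suc i)). \<phi> i u = 0}" for i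
    unfolding a_kernel_def' by simp
  ultimately show ?thesis
    unfolding minimal_graded_free_resolution_def Let_def
    using residue_comp_hom[OF I e] cyclic_min_resD(2,4,5,6)[OF F] by simp
qed

text \<open>The augmentation maps basis vectors to residue classes of homogeneous polynomials; choosing
representatives gives the lift \<open>e\<close>.\<close>

lemma cyclic_of_minimal_resolution:
  fixes I :: "('v, 'k::field) mpoly set"
  assumes I: "ideal I (poly_ring V)"
    and F: "minimal_graded_free_resolution V (quotient_module V I) ds \<phi> \<epsilon>"
  shows "\<exists>e. cyclic_min_res V I ds \<phi> e"
proof -
  note Q = quotient_module_sel[OF I]
  note F' = F[unfolded minimal_graded_free_resolution_def Let_def]
  have \<epsilon>: "\<epsilon> \<in> graded_hom V (graded_free V (ds 0)) (quotient_module V I)"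
    by (rule F'[THEN conjunct1])
  have \<phi>: "\<forall>i. \<phi> i \<in> hom_free V (ds (Suc i)) (ds i)"
    by (rule F'[THEN conjunct2, THEN conjunct1])
  have onto: "\<epsilon> ` vecs V (ds 0) = carrier (quotient_module V I)"
    by (rule F'[THEN conjunct2, THEN conjunct2, THEN conjunct1])
  have ex0: "\<phi> 0 ` vecs V (ds 1) = a_kernel (graded_free V (ds 0)) (quotient_module V I) \<epsilon>"
    by (rule F'[THEN conjunct2, THEN conjunct2, THEN conjunct2, THEN conjunct1])
  have exS: "\<forall>i. \<phi> (Suc i) ` vecs V (ds (Suc (Suc i))) =
      a_kernel (graded_free V (ds (Suc i))) (graded_free V (ds i)) (\<phi> i)"
    by (rule F'[THEN conjunct2, THEN conjunct2, THEN conjunct2, THEN conjunct2, THEN conjunct1])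
  have min: "\<forall>i. \<forall>u\<in>vecs V (ds (Suc i)). \<forall>k<length (ds i). \<phi> i u k \<in> irrelevant_ideal V"
    by (rule F'[THEN conjunct2, THEN conjunct2, THEN conjunct2, THEN conjunct2, THEN conjunct2])
  have "\<exists>s. s \<in> homogeneous V (ds 0 ! k) \<and> \<epsilon> (basis_vec k) = residue V I s"
    if k: "k < length (ds 0)" for k
    using graded_hom_free_linear(4)[OF \<epsilon> basis_vec_grade[OF k]] unfolding Q(5) by auto
  then obtain s where s: "\<And>k. k < length (ds 0) \<Longrightarrow> s k \<in> homogeneous V (ds 0 ! k)"
    "\<And>k. k < length (ds 0) \<Longrightarrow> \<epsilon> (basis_vec k) = residue V I (s k)"
    by metis
  define b where "b = (\<lambda>k l. if l = (0::nat) then s k else 0)"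
  let ?e = "lin_ext (length (ds 0)) b"
  have e: "?e \<in> hom_free V (ds 0) [0]"
    by (rule lin_ext_hom) (use s(1) in \<open>auto simp: grade_free_iff b_def\<close>)
  have \<epsilon>e: "\<epsilon> u = residue V I (?e u 0)" if u: "u \<in> vecs V (ds 0)" for u
  proof (rule linear_eq_on_basis[OF module_quotient_module[OF I] \<epsilon> residue_comp_hom[OF I e] _ u])
    fix k assume "k < length (ds 0)"
    then show "\<epsilon> (basis_vec k) = residue V I (?e (basis_vec k) 0)"
      by (simp only: s(2) lin_ext_basis_vec) (simp add: b_def)
  qed
  have "\<exists>u\<in>vecs V (ds 0). t - ?e u 0 \<in> I" if "t \<in> polys V" for t
  proof -
    have "residue V I t \<in> \<epsilon> ` vecs V (ds 0)"
      using that unfolding onto Q(1) by (rule imageI)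
    then obtain u where u: "residue V I t = \<epsilon> u" "u \<in> vecs V (ds 0)" by (rule imageE)
    then have "t - ?e u 0 \<in> I"
      unfolding \<epsilon>e[OF u(2)] residue_eq_iff[OF I] by simp
    with u(2) show ?thesis by auto
  qed
  moreover have "\<phi> 0 ` vecs V (ds (Suc 0)) = {u \<in> vecs V (ds 0). ?e u 0 \<in> I}"
    using ex0 unfolding a_kernel_def' Q(4) by (simp add: \<epsilon>e residue_eq_iff[OF I] cong: conj_cong)
  moreover have "\<forall>i. \<phi> (Suc i) ` vecs V (ds (Suc (Suc i))) = {u \<in> vecs V (ds (Suc i)). \<phi> i u = 0}"
    using exS unfolding a_kernel_def' by simp
  ultimately have "cyclic_min_res V I ds \<phi> ?e"
    unfolding cyclic_min_res_def using e \<phi> min by (intro conjI ballI) simp_all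
  then show ?thesis by blast
qed

text \<open>Witnessed by a finite minimal resolution that starts with \<open>S\<close> itself.  This normal form is preserved by the
mapping cone and makes the degree zero part of the comparison map explicit: it is multiplication by a
polynomial.\<close>

definition has_reg :: "'v set \<Rightarrow> ('v, 'k::field) mpoly set \<Rightarrow> int \<Rightarrow> bool" where
  "has_reg V I r \<longleftrightarrow> (\<exists>ds \<phi>. ds 0 = [0] \<and> cyclic_min_res V I ds \<phi> (\<lambda>u. u) \<and>
     (\<exists>N. \<forall>i\<ge>N. ds i = []) \<and> (\<forall>i. \<forall>j\<in>set (ds i). j - int i \<le> r) \<and>
     (\<exists>i. \<exists>j\<in>set (ds i). j - int i = r))"

text \<open>The resolution chosen in the definition of Betti numbers exists because the witness is one, and by
\<open>shifts_unique\<close> it has the same twists as the witness.\<close>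

lemma regularity_eq_has_reg:
  fixes I :: "('v, 'k::field) mpoly set"
  assumes I: "ideal I (poly_ring V)" "hcomp_closed I" and reg: "has_reg V I r"
  shows "regularity V (quotient_module V I) = r"
proof -
  obtain ds \<phi> where ds: "ds 0 = [0]" "cyclic_min_res V I ds \<phi> (\<lambda>u. u)"
    "\<exists>N. \<forall>i\<ge>N. ds i = []" "\<forall>i. \<forall>j\<in>set (ds i). j - int i \<le> r" "\<exists>i. \<exists>j\<in>set (ds i). j - int i = r"
    using reg unfolding has_reg_def by auto
  define es where "es = (SOME ds. \<exists>\<phi> \<epsilon>. minimal_graded_free_resolution V (quotient_module V I) ds \<phi> \<epsilon>)"
  have "\<exists>\<phi> \<epsilon>. minimal_graded_free_resolution V (quotient_module V I) es \<phi> \<epsilon>"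
    unfolding es_def using minimal_resolution_of_cyclic[OF I(1) ds(2)]
    by (intro someI_ex[of "\<lambda>ds. \<exists>\<phi> \<epsilon>. minimal_graded_free_resolution V (quotient_module V I) ds \<phi> \<epsilon>"]) blast
  then obtain \<phi>' \<epsilon>' where "minimal_graded_free_resolution V (quotient_module V I) es \<phi>' \<epsilon>'"
    by (elim exE)
  from cyclic_of_minimal_resolution[OF I(1) this] obtain e' where G: "cyclic_min_res V I es \<phi>' e'"
    by (rule exE)
  have "set (es i) = set (ds i)" for i
    using shifts_unique[OF I ds(2) G] shifts_unique[OF I G ds(2)] by (rule equalityI[rotated])
  then have betti: "betti V (quotient_module V I) i j \<noteq> 0 \<longleftrightarrow> j \<in> set (ds i)" for i j
    by (simp add: betti_def Let_def count_list_0_iff flip: es_def)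
  let ?A = "{j - int i | i j. j \<in> set (ds i)}"
  obtain N where N: "\<And>i. i \<ge> N \<Longrightarrow> ds i = []" using ds(3) by auto
  have "?A \<subseteq> (\<Union>i<N. (\<lambda>j. j - int i) ` set (ds i))"
  proof
    fix x assume "x \<in> ?A"
    then obtain i j where "x = j - int i" "j \<in> set (ds i)" by auto
    moreover from this have "i < N" using N[of i] by (cases "i < N") auto
    ultimately show "x \<in> (\<Union>i<N. (\<lambda>j. j - int i) ` set (ds i))" by auto
  qed
  then have "finite ?A" by (rule finite_subset) simp
  moreover have "r \<in> ?A" using ds(5) by auto
  moreover have "\<And>x. x \<in> ?A \<Longrightarrow> x \<le> r" using ds(4) by auto
  ultimately show ?thesis
    unfolding regularity_def betti by (intro Max_eqI)
qed


section \<open>The minimal mapping cone\<close>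

text \<open>The isomorphism from \<open>F \<oplus> G\<close>, with \<open>F\<close> of rank \<open>n\<close>, onto the free module on the concatenated list of
degrees.\<close>

definition pack :: "nat \<Rightarrow> (nat \<Rightarrow> 'a) \<Rightarrow> (nat \<Rightarrow> 'a) \<Rightarrow> nat \<Rightarrow> 'a" where
  "pack n x y = (\<lambda>k. if k < n then x k else y (k - n))"

definition front :: "nat \<Rightarrow> (nat \<Rightarrow> 'a) \<Rightarrow> nat \<Rightarrow> 'a::zero" where
  "front n u = (\<lambda>k. if k < n then u k else 0)"

definition rear :: "nat \<Rightarrow> (nat \<Rightarrow> 'a) \<Rightarrow> nat \<Rightarrow> 'a" where
  "rear n u = (\<lambda>k. u (k + n))"

lemma pack_front_rear: "pack n (front n u) (rear n u) = u"
  by (auto simp: pack_def front_def rear_def fun_eq_iff)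

lemma front_pack: "x \<in> vecs V ds \<Longrightarrow> front (length ds) (pack (length ds) x y) = x"
  by (auto simp: pack_def front_def vecs_iff fun_eq_iff)

lemma rear_pack: "rear n (pack n x y) = y"
  by (auto simp: pack_def rear_def fun_eq_iff)

lemma pack_vecs: "x \<in> vecs V ds \<Longrightarrow> y \<in> vecs V es \<Longrightarrow> pack (length ds) x y \<in> vecs V (ds @ es)"
  by (auto simp: pack_def vecs_iff)

lemma front_vecs: "u \<in> vecs V (ds @ es) \<Longrightarrow> front (length ds) u \<in> vecs V ds"
  by (auto simp: front_def vecs_iff)

lemma rear_vecs: "u \<in> vecs V (ds @ es) \<Longrightarrow> rear (length ds) u \<in> vecs V es"
  by (auto simp: rear_def vecs_iff)

lemma pack_eq_0: "x \<in> vecs V ds \<Longrightarrow> pack (length ds) x y = 0 \<Longrightarrow> x = 0 \<and> y = 0"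
proof -
  assume x: "x \<in> vecs V ds" and 0: "pack (length ds) x y = 0"
  have "x = front (length ds) (pack (length ds) x y)" by (simp only: front_pack[OF x])
  also have "\<dots> = 0" unfolding 0 by (simp add: front_def fun_eq_iff)
  finally have "x = 0" .
  moreover have "y = 0"
    using rear_pack[of "length ds" x y] unfolding 0 by (simp add: rear_def fun_eq_iff)
  ultimately show ?thesis by simp
qed

lemma front_hom: "front (length ds) \<in> hom_free V (ds @ es) ds"
proof (rule hom_freeI)
  fix d and u :: "nat \<Rightarrow> ('a, 'b) mpoly"
  assume "u \<in> grade (graded_free V (ds @ es)) d"
  then show "front (length ds) u \<in> grade (graded_free V ds) d"
    by (auto simp: grade_free_iff front_def nth_append split: if_splits)
qed (auto simp: front_vecs, auto simp: front_def fun_eq_iff)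

lemma rear_hom: "rear (length ds) \<in> hom_free V (ds @ es) es"
proof (rule hom_freeI)
  fix d and u :: "nat \<Rightarrow> ('a, 'b) mpoly"
  assume u: "u \<in> grade (graded_free V (ds @ es)) d"
  have "u (k + length ds) \<in> homogeneous V (d - es ! k)" if "k < length es" for k
    using u that by (auto simp: grade_free_iff nth_append dest: spec[of _ "k + length ds"])
  then show "rear (length ds) u \<in> grade (graded_free V es) d"
    using u by (auto simp: grade_free_iff rear_def)
qed (auto simp: rear_vecs, auto simp: rear_def fun_eq_iff)

lemma pack_hom:
  assumes a: "a \<in> hom_free V as ds" and b: "b \<in> hom_free V as es"
  shows "(\<lambda>u. pack (length ds) (a u) (b u)) \<in> hom_free V as (ds @ es)"
proof (rule hom_freeI)
  fix d and u :: "nat \<Rightarrow> ('a, 'b) mpoly"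
  assume "u \<in> grade (graded_free V as) d"
  then have "a u \<in> grade (graded_free V ds) d" "b u \<in> grade (graded_free V es) d"
    by (rule hom_free_grade[OF a], rule hom_free_grade[OF b])
  then show "pack (length ds) (a u) (b u) \<in> grade (graded_free V (ds @ es)) d"
    by (auto simp: grade_free_iff pack_def nth_append)
qed (simp_all add: pack_vecs hom_free_vecs[OF a] hom_free_vecs[OF b],
     simp_all add: pack_def fun_eq_iff hom_free_add[OF a] hom_free_add[OF b]
       hom_free_scale[OF a] hom_free_scale[OF b])

text \<open>The cone of \<open>w g\<close>, where \<open>g\<close> lifts multiplication by \<open>m : S/C \<rightarrow> S/I\<close>.  The hypotheses say
\<open>I : m = I : wm = C\<close>.  Every entry of \<open>w g\<close> is a multiple of the variable \<open>w\<close>, so the cone is minimal for each choice of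
the lift \<open>g\<close>.  The second summand of the \<open>i\<close>-th module of the cone is the module number
\<open>i - 1\<close> of the resolution of \<open>S/C\<close>, shifted by the degree \<open>c + 1\<close> of \<open>wm\<close>.\<close>

lemma mapping_cone:
  fixes I C :: "('v, 'k::field) mpoly set"
  assumes I: "ideal I (poly_ring V)" and w: "w \<in> V" and m: "m \<in> homogeneous V c"
    and F: "cyclic_min_res V I ds \<phi> (\<lambda>u. u)" and ds0: "ds 0 = [0]"
    and G: "cyclic_min_res V C es \<psi> (\<lambda>u. u)" and es0: "es 0 = [0]"
    and colon: "\<And>f. f \<in> C \<Longrightarrow> m * f \<in> I"
      "\<And>f. f \<in> polys V \<Longrightarrow> Var w * (m * f) \<in> I \<Longrightarrow> f \<in> C"
    and prev: "prev = (\<lambda>i. case i of 0 \<Rightarrow> [] | Suc i' \<Rightarrow> map ((+) (c + 1)) (es i'))"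
    and J: "J = {f \<in> polys V. \<exists>a\<in>polys V. f - Var w * (m * a) \<in> I}"
  shows "\<exists>\<Phi>. cyclic_min_res V J (\<lambda>i. ds i @ prev i) \<Phi> (\<lambda>u. u)"
proof -
  note Ip = ideal_props[OF I]
  note \<phi> = cyclic_min_resD(2)[OF F] and \<psi> = cyclic_min_resD(2)[OF G]
  note imI = cyclic_min_resD(4)[OF F] and imC = cyclic_min_resD(4)[OF G]
  have mV: "m \<in> polys V" by (rule homogeneous_polys[OF m])
  have wV: "Var w \<in> polys V" using w by simp
  have "\<exists>g. g 0 = scale m \<and> (\<forall>i. g i \<in> hom_free V (map ((+) c) (es i)) (ds i)) \<and>
    (\<forall>i. \<forall>u\<in>vecs V (map ((+) c) (es (Suc i))). \<phi> i (g (Suc i) u) = g i (\<psi> i u))"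
  proof (rule extend_chain_map)
    show "\<psi> i \<in> hom_free V (map ((+) c) (es (Suc i))) (map ((+) c) (es i))" for i
      by (rule hom_free_shift[OF \<psi>])
    show "\<phi> i \<in> hom_free V (ds (Suc i)) (ds i)" for i by (rule \<phi>)
    show "\<psi> i (\<psi> (Suc i) u) = 0" if "u \<in> vecs V (map ((+) c) (es (Suc (Suc i))))" for i u
      using that unfolding vecs_shift by (rule cyclic_min_res_complex[OF G])
    show "v \<in> \<phi> (Suc i) ` vecs V (ds (Suc (Suc i)))" if "v \<in> vecs V (ds (Suc i))" "\<phi> i v = 0" for i v
      unfolding cyclic_min_resD(5)[OF F] using that by simp
    show "scale m \<in> hom_free V (map ((+) c) (es 0)) (ds 0)"
      using hom_free_mult[OF hom_free_ident m, of "[0]"] by (simp only: es0 ds0)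
    show "scale m (\<psi> 0 u) \<in> \<phi> 0 ` vecs V (ds (Suc 0))" if u: "u \<in> vecs V (map ((+) c) (es (Suc 0)))" for u
    proof -
      have "\<psi> 0 u \<in> \<psi> 0 ` vecs V (es (Suc 0))" using u unfolding vecs_shift by (rule imageI)
      then have "\<psi> 0 u \<in> vecs V (es 0)" "\<psi> 0 u 0 \<in> C" unfolding imC by simp_all
      then show ?thesis
        unfolding imI using colon(1) vecs_scale[OF mV, of "\<psi> 0 u" "ds 0"] by (simp add: es0 ds0)
    qed
  qed
  then obtain g where g0: "g 0 = scale m" and g: "\<And>i. g i \<in> hom_free V (map ((+) c) (es i)) (ds i)"
    and gS': "\<forall>i. \<forall>u\<in>vecs V (map ((+) c) (es (Suc i))). \<phi> i (g (Suc i) u) = g i (\<psi> i u)"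
    by auto
  note gS = gS'[unfolded vecs_shift, rule_format]
  have prev_Suc: "prev (Suc i) = map ((+) (c + 1)) (es i)" for i by (simp add: prev)
  have prev_vecs: "vecs V (prev (Suc i)) = (vecs V (es i) :: (nat \<Rightarrow> ('v, 'k) mpoly) set)" for i
    by (simp only: prev_Suc vecs_shift)
  define W where "W i u = scale (Var w) (g i u)" for i u
  have W: "W i \<in> hom_free V (prev (Suc i)) (ds i)" for i
  proof -
    have "map ((+) 1) (map ((+) c) (es i)) = prev (Suc i)"
      by (simp add: prev_Suc)
    with hom_free_mult[OF g homogeneous_Var[OF w], of i] show ?thesis
      by (simp only: W_def[abs_def])
  qed
  have W0: "W 0 u 0 = Var w * (m * u 0)" for u
    by (simp add: W_def g0)
  have WS: "\<phi> i (W (Suc i) u) = W i (\<psi> i u)" if "u \<in> vecs V (es (Suc i))" for i u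
  proof -
    have "g (Suc i) u \<in> vecs V (ds (Suc i))"
      using that by (intro hom_free_vecs[OF g]) (simp only: vecs_shift)
    from hom_free_scale[OF \<phi> wV this] show ?thesis
      by (simp only: W_def gS[OF that])
  qed
  define \<eta> :: "nat \<Rightarrow> (nat \<Rightarrow> ('v, 'k) mpoly) \<Rightarrow> nat \<Rightarrow> ('v, 'k) mpoly"
    where "\<eta> i = (case i of 0 \<Rightarrow> (\<lambda>u. 0) | Suc i' \<Rightarrow> \<psi> i')" for i
  have \<eta>: "\<eta> i \<in> hom_free V (prev (Suc i)) (prev i)" for i
  proof (cases i)
    case 0
    then show ?thesis using hom_free_null by (simp add: \<eta>_def)
  next
    case (Suc i')
    then show ?thesis using hom_free_shift[OF \<psi>[of i'], of "c + 1"] by (simp add: \<eta>_def prev_Suc)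
  qed
  have \<eta>_Suc: "\<eta> (Suc i) = \<psi> i" for i by (simp add: \<eta>_def)
  define \<Phi> where "\<Phi> i u = pack (length (ds i))
    (\<phi> i (front (length (ds (Suc i))) u) + W i (rear (length (ds (Suc i))) u))
    (- \<eta> i (rear (length (ds (Suc i))) u))" for i u
  have \<Phi>: "\<Phi> i \<in> hom_free V (ds (Suc i) @ prev (Suc i)) (ds i @ prev i)" for i
    unfolding \<Phi>_def[abs_def]
    by (intro pack_hom hom_free_plus hom_free_neg hom_free_comp[OF front_hom \<phi>] hom_free_comp[OF rear_hom W]
        hom_free_comp[OF rear_hom \<eta>])
  have \<Phi>_pack: "\<Phi> i (pack (length (ds (Suc i))) x y) = pack (length (ds i)) (\<phi> i x + W i y) (- \<eta> i y)"
    if "x \<in> vecs V (ds (Suc i))" for i x y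
    by (simp only: \<Phi>_def front_pack[OF that] rear_pack)
  have split: "\<exists>x\<in>vecs V (ds i). \<exists>y\<in>vecs V (prev i). u = pack (length (ds i)) x y"
    if "u \<in> vecs V (ds i @ prev i)" for i u
    by (rule bexI[OF _ front_vecs[OF that]], rule bexI[OF _ rear_vecs[OF that]])
      (simp only: pack_front_rear)
  have complex: "\<Phi> i (\<Phi> (Suc i) u) = 0" if u: "u \<in> vecs V (ds (Suc (Suc i)) @ prev (Suc (Suc i)))" for i u
  proof -
    obtain x y where xy: "x \<in> vecs V (ds (Suc (Suc i)))" "y \<in> vecs V (es (Suc i))"
      "u = pack (length (ds (Suc (Suc i)))) x y"
      using split[OF u] unfolding prev_vecs by auto
    have y: "y \<in> vecs V (prev (Suc (Suc i)))" using xy(2) by (simp only: prev_vecs)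
    have v: "\<phi> (Suc i) x \<in> vecs V (ds (Suc i))" "W (Suc i) y \<in> vecs V (ds (Suc i))"
      "\<psi> i y \<in> vecs V (prev (Suc i))"
      using hom_free_vecs[OF \<phi> xy(1)] hom_free_vecs[OF W y] hom_free_vecs[OF \<psi> xy(2)]
      by (simp_all only: prev_vecs)
    have "\<phi> i (\<phi> (Suc i) x + W (Suc i) y) + W i (- \<psi> i y) = 0"
      by (simp only: hom_free_add[OF \<phi> v(1,2)] cyclic_min_res_complex[OF F xy(1)] WS[OF xy(2)]
          hom_free_uminus[OF W v(3)] add_0_left add.right_inverse)
    moreover have "\<eta> i (\<psi> i y) = 0"
      using cyclic_min_res_complex[OF G, of y] xy(2) by (cases i) (simp_all add: \<eta>_def)
    then have "\<eta> i (- \<psi> i y) = 0"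
      by (simp only: hom_free_uminus[OF \<eta> v(3)] neg_equal_0_iff_equal)
    ultimately show ?thesis
      by (simp only: xy(3) \<Phi>_pack[OF xy(1)] \<Phi>_pack[OF vecs_add[OF v(1,2)]] \<eta>_Suc)
        (simp add: pack_def fun_eq_iff)
  qed
  have exact: "u \<in> \<Phi> (Suc i) ` vecs V (ds (Suc (Suc i)) @ prev (Suc (Suc i)))"
    if u: "u \<in> vecs V (ds (Suc i) @ prev (Suc i))" and u0: "\<Phi> i u = 0" for i u
  proof -
    obtain x y where xy: "x \<in> vecs V (ds (Suc i))" "y \<in> vecs V (es i)" "u = pack (length (ds (Suc i))) x y"
      using split[OF u] unfolding prev_vecs by auto
    have y: "y \<in> vecs V (prev (Suc i))" using xy(2) by (simp only: prev_vecs)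
    have "pack (length (ds i)) (\<phi> i x + W i y) (- \<eta> i y) = 0"
      using u0 unfolding xy(3) \<Phi>_pack[OF xy(1)] .
    from pack_eq_0[OF vecs_add[OF hom_free_vecs[OF \<phi> xy(1)] hom_free_vecs[OF W y]] this]
    have 0: "\<phi> i x + W i y = 0" "\<eta> i y = 0" by simp_all
    \<comment> \<open>At the bottom of the cone exactness of the second row is replaced by \<open>I : wm = C\<close>.\<close>
    have "y \<in> \<psi> i ` vecs V (es (Suc i))"
    proof (cases i)
      case i: 0
      have "\<phi> 0 x \<in> \<phi> 0 ` vecs V (ds (Suc 0))" using xy(1) unfolding i by (rule imageI)
      then have "\<phi> 0 x 0 \<in> I" unfolding imI by simp
      moreover have "Var w * (m * y 0) = - \<phi> 0 x 0"
        using fun_cong[OF 0(1), of 0] unfolding i by (simp add: W0 eq_neg_iff_add_eq_0 add.commute)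
      ultimately have "Var w * (m * y 0) \<in> I" using Ip(5) by simp
      from colon(2)[OF vecs_polys[OF xy(2)] this] have "y 0 \<in> C" .
      then show ?thesis using xy(2) unfolding i imC by simp
    next
      case (Suc i')
      then show ?thesis
        using 0(2) xy(2) unfolding Suc cyclic_min_resD(5)[OF G] \<eta>_Suc by simp
    qed
    then obtain t2 where t2: "t2 \<in> vecs V (es (Suc i))" "y = \<psi> i t2" by auto
    have t2': "t2 \<in> vecs V (prev (Suc (Suc i)))" using t2(1) by (simp only: prev_vecs)
    have Wt: "W (Suc i) t2 \<in> vecs V (ds (Suc i))" by (rule hom_free_vecs[OF W t2'])
    have "\<phi> i (x + W (Suc i) t2) = 0"
      by (simp only: hom_free_add[OF \<phi> xy(1) Wt] WS[OF t2(1)] 0(1) flip: t2(2))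
    then have "x + W (Suc i) t2 \<in> \<phi> (Suc i) ` vecs V (ds (Suc (Suc i)))"
      unfolding cyclic_min_resD(5)[OF F] using vecs_add[OF xy(1) Wt] by (simp only: mem_Collect_eq)
    then obtain t1 where t1: "t1 \<in> vecs V (ds (Suc (Suc i)))" "x + W (Suc i) t2 = \<phi> (Suc i) t1" by auto
    have "\<Phi> (Suc i) (pack (length (ds (Suc (Suc i)))) t1 (- t2)) =
        pack (length (ds (Suc i))) (x + W (Suc i) t2 + W (Suc i) (- t2)) (- \<psi> i (- t2))"
      by (simp only: \<Phi>_pack[OF t1(1)] t1(2) \<eta>_Suc)
    also have "\<dots> = u"
      by (simp only: hom_free_uminus[OF W t2'] hom_free_uminus[OF \<psi> t2(1)] xy(3) add.assoc
          add.right_inverse add_0_right minus_minus flip: t2(2))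
    finally show ?thesis
      using pack_vecs[OF t1(1) vecs_uminus[OF t2']] by (intro image_eqI) (simp_all only:)
  qed
  have prev0: "prev 0 = []" by (simp add: prev)
  have aug: "\<Phi> 0 ` vecs V (ds (Suc 0) @ prev (Suc 0)) = {u \<in> vecs V (ds 0 @ prev 0). u 0 \<in> J}"
  proof (intro equalityI subsetI)
    fix v assume "v \<in> \<Phi> 0 ` vecs V (ds (Suc 0) @ prev (Suc 0))"
    then obtain u where u: "u \<in> vecs V (ds (Suc 0) @ prev (Suc 0))" "v = \<Phi> 0 u" by auto
    obtain x y where xy: "x \<in> vecs V (ds (Suc 0))" "y \<in> vecs V (es 0)" "u = pack (length (ds (Suc 0))) x y"
      using split[OF u(1)] unfolding prev_vecs by auto
    have vV: "v \<in> vecs V (ds 0 @ prev 0)" unfolding u(2) by (rule hom_free_vecs[OF \<Phi> u(1)])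
    have "\<phi> 0 x \<in> \<phi> 0 ` vecs V (ds (Suc 0))" using xy(1) by (rule imageI)
    then have "\<phi> 0 x 0 \<in> I" unfolding imI by simp
    moreover have "v 0 = \<phi> 0 x 0 + Var w * (m * y 0)"
      unfolding u(2) xy(3) \<Phi>_pack[OF xy(1)] by (simp add: pack_def ds0 W0)
    ultimately have "v 0 - Var w * (m * y 0) \<in> I" by simp
    then show "v \<in> {u \<in> vecs V (ds 0 @ prev 0). u 0 \<in> J}"
      using vV vecs_polys[OF vV] vecs_polys[OF xy(2)] by (auto simp: J)
  next
    fix v assume "v \<in> {u \<in> vecs V (ds 0 @ prev 0). u 0 \<in> J}"
    then have v: "v \<in> vecs V [0]" and "v 0 \<in> J" by (simp_all add: prev0 ds0)
    then obtain a where a: "a \<in> polys V" "v 0 - Var w * (m * a) \<in> I" by (auto simp: J)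
    let ?y = "\<lambda>k. if k = (0::nat) then a else 0"
    let ?z = "\<lambda>k. if k = (0::nat) then v 0 - Var w * (m * a) else 0"
    have y: "?y \<in> vecs V (es 0)" using a(1) by (simp add: vecs_iff es0)
    have "?z \<in> \<phi> 0 ` vecs V (ds (Suc 0))"
      unfolding imI using a(2) Ip(1) by (auto simp: vecs_iff ds0)
    then obtain x where x: "x \<in> vecs V (ds (Suc 0))" "?z = \<phi> 0 x" by (rule imageE)
    have "\<Phi> 0 (pack (length (ds (Suc 0))) x ?y) = v"
      unfolding \<Phi>_pack[OF x(1)] x(2)[symmetric] using v
      by (auto simp: pack_def fun_eq_iff ds0 W0 \<eta>_def vecs_iff)
    then show "v \<in> \<Phi> 0 ` vecs V (ds (Suc 0) @ prev (Suc 0))"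
      using pack_vecs[OF x(1), of ?y "prev (Suc 0)"] y unfolding prev_vecs
      by (intro image_eqI[of _ _ "pack (length (ds (Suc 0))) x ?y"]) simp_all
  qed
  have minimal: "\<Phi> i u k \<in> irrelevant_ideal V"
    if u: "u \<in> vecs V (ds (Suc i) @ prev (Suc i))" and k: "k < length (ds i @ prev i)" for i u k
  proof -
    note mp = ideal_props[OF irrelevant_ideal_is_ideal]
    obtain x y where xy: "x \<in> vecs V (ds (Suc i))" "y \<in> vecs V (es i)" "u = pack (length (ds (Suc i))) x y"
      using split[OF u] unfolding prev_vecs by auto
    show ?thesis
    proof (cases "k < length (ds i)")
      case True
      have "g i y k \<in> polys V"
        using xy(2) by (intro vecs_polys[OF hom_free_vecs[OF g]]) (simp only: vecs_shift)
      then have "g i y k * Var w \<in> irrelevant_ideal V"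
        by (rule mp(4)[OF _ Var_in_irrelevant_ideal[OF w]])
      then have "\<phi> i x k + W i y k \<in> irrelevant_ideal V"
        using mp(3)[OF cyclic_min_resD(6)[OF F xy(1) True]] by (simp add: W_def mult.commute)
      then show ?thesis
        unfolding xy(3) \<Phi>_pack[OF xy(1)] using True by (simp add: pack_def)
    next
      case False
      with k have i: "i \<noteq> 0" by (cases i) (simp_all add: prev0)
      then obtain i' where i': "i = Suc i'" by (cases i) simp_all
      have "\<psi> i' y (k - length (ds i)) \<in> irrelevant_ideal V"
        using xy(2) k False unfolding i' by (intro cyclic_min_resD(6)[OF G]) (auto simp: prev_Suc)
      from mp(5)[OF this] show ?thesis
        unfolding xy(3) \<Phi>_pack[OF xy(1)] using False by (simp add: pack_def i' \<eta>_Suc)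
    qed
  qed
  have "cyclic_min_res V J (\<lambda>i. ds i @ prev i) \<Phi> (\<lambda>u. u)"
    unfolding cyclic_min_res_def
  proof (intro conjI allI ballI impI)
    show "(\<lambda>u. u) \<in> hom_free V (ds 0 @ prev 0) [0]"
      by (simp only: ds0 prev0 append_Nil2 hom_free_ident)
    show "\<Phi> i \<in> hom_free V (ds (Suc i) @ prev (Suc i)) (ds i @ prev i)" for i by (rule \<Phi>)
    show "\<exists>u\<in>vecs V (ds 0 @ prev 0). s - u 0 \<in> J" if "s \<in> polys V" for s
    proof (rule bexI)
      show "(\<lambda>k. if k = 0 then s else 0) \<in> vecs V (ds 0 @ prev 0)"
        using that by (simp add: vecs_iff ds0 prev0)
      show "s - (if (0::nat) = 0 then s else 0) \<in> J"
        using Ip(2) by (auto simp: J intro: bexI[of _ 0])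
    qed
    show "\<Phi> 0 ` vecs V (ds (Suc 0) @ prev (Suc 0)) = {u \<in> vecs V (ds 0 @ prev 0). u 0 \<in> J}" by (rule aug)
    show "\<Phi> (Suc i) ` vecs V (ds (Suc (Suc i)) @ prev (Suc (Suc i))) =
        {u \<in> vecs V (ds (Suc i) @ prev (Suc i)). \<Phi> i u = 0}" for i
    proof (intro equalityI subsetI)
      fix v assume "v \<in> \<Phi> (Suc i) ` vecs V (ds (Suc (Suc i)) @ prev (Suc (Suc i)))"
      then obtain u where u: "v = \<Phi> (Suc i) u" "u \<in> vecs V (ds (Suc (Suc i)) @ prev (Suc (Suc i)))"
        by (rule imageE)
      show "v \<in> {u \<in> vecs V (ds (Suc i) @ prev (Suc i)). \<Phi> i u = 0}"
        unfolding u(1) using complex[OF u(2)] hom_free_vecs[OF \<Phi> u(2)] by simp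
    next
      fix v assume "v \<in> {u \<in> vecs V (ds (Suc i) @ prev (Suc i)). \<Phi> i u = 0}"
      then show "v \<in> \<Phi> (Suc i) ` vecs V (ds (Suc (Suc i)) @ prev (Suc (Suc i)))"
        by (intro exact) simp_all
    qed
    show "\<Phi> i u k \<in> irrelevant_ideal V"
      if "u \<in> vecs V (ds (Suc i) @ prev (Suc i))" "k < length (ds i @ prev i)" for i u k
      using that by (rule minimal)
  qed
  then show ?thesis by blast
qed

lemma has_reg_zero_ideal: "has_reg V ({0} :: ('v, 'k::field) mpoly set) 0"
proof -
  let ?ds = "\<lambda>i::nat. if i = 0 then [0::int] else []"
  have nil: "(vecs V [] :: (nat \<Rightarrow> ('v, 'k) mpoly) set) = {0}"
    by (auto simp: vecs_iff fun_eq_iff)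
  have one: "{u \<in> vecs V [0]. u 0 = (0 :: ('v, 'k) mpoly)} = {0}"
    by (auto simp: vecs_iff fun_eq_iff) (metis One_nat_def Suc_leI gr0I)
  have "cyclic_min_res V ({0} :: ('v, 'k) mpoly set) ?ds (\<lambda>i u. 0) (\<lambda>u. u)"
    unfolding cyclic_min_res_def
  proof (intro conjI allI ballI impI)
    show "\<exists>u\<in>vecs V (?ds 0). s - u 0 \<in> {0}" if "s \<in> polys V" for s :: "('v, 'k) mpoly"
      using that by (intro bexI[of _ "\<lambda>k. if k = 0 then s else 0"]) (simp_all add: vecs_iff)
    show "(0 :: nat \<Rightarrow> ('v, 'k) mpoly) k \<in> irrelevant_ideal V" for k
      using ideal_props(2)[OF irrelevant_ideal_is_ideal] by simp
  qed (simp_all add: hom_free_ident hom_free_null nil one cong: conj_cong)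
  then show ?thesis
    unfolding has_reg_def
    by (intro exI[of _ ?ds] exI[of _ "\<lambda>i u. 0"] conjI exI[of _ 1] exI[of _ 0]) auto
qed

text \<open>The second summand of the cone moves up by \<open>c + 1\<close> in internal degree and by one in homological
degree, so it contributes \<open>r' + c\<close>.\<close>

lemma has_reg_mapping_cone:
  fixes I C :: "('v, 'k::field) mpoly set"
  assumes I: "ideal I (poly_ring V)" and w: "w \<in> V" and m: "m \<in> homogeneous V c"
    and F: "has_reg V I r" and G: "has_reg V C r'"
    and colon: "\<And>f. f \<in> C \<Longrightarrow> m * f \<in> I"
      "\<And>f. f \<in> polys V \<Longrightarrow> Var w * (m * f) \<in> I \<Longrightarrow> f \<in> C"
    and J: "J = {f \<in> polys V. \<exists>a\<in>polys V. f - Var w * (m * a) \<in> I}"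
  shows "has_reg V J (max r (r' + c))"
proof -
  obtain ds \<phi> where ds: "ds 0 = [0]" "cyclic_min_res V I ds \<phi> (\<lambda>u. u)"
    "\<exists>N. \<forall>i\<ge>N. ds i = []" "\<forall>i. \<forall>j\<in>set (ds i). j - int i \<le> r" "\<exists>i. \<exists>j\<in>set (ds i). j - int i = r"
    using F unfolding has_reg_def by auto
  obtain es \<psi> where es: "es 0 = [0]" "cyclic_min_res V C es \<psi> (\<lambda>u. u)"
    "\<exists>N. \<forall>i\<ge>N. es i = []" "\<forall>i. \<forall>j\<in>set (es i). j - int i \<le> r'" "\<exists>i. \<exists>j\<in>set (es i). j - int i = r'"
    using G unfolding has_reg_def by auto
  obtain N where N: "\<forall>i\<ge>N. ds i = []" using ds(3) by blast
  obtain N' where N': "\<forall>i\<ge>N'. es i = []" using es(3) by blast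
  define prev where "prev = (\<lambda>i. case i of 0 \<Rightarrow> [] | Suc i' \<Rightarrow> map ((+) (c + 1)) (es i'))"
  let ?ds = "\<lambda>i. ds i @ prev i"
  have "\<exists>\<Phi>. cyclic_min_res V J ?ds \<Phi> (\<lambda>u. u)"
    by (rule mapping_cone[OF I w m ds(2,1) es(2,1) _ _ prev_def J]) (erule colon(1), erule (1) colon(2))
  then obtain \<Phi> where \<Phi>: "cyclic_min_res V J ?ds \<Phi> (\<lambda>u. u)" by (rule exE)
  have le: "j - int i \<le> max r (r' + c)" if j: "j \<in> set (?ds i)" for i j
  proof (cases "j \<in> set (ds i)")
    case True
    then show ?thesis using ds(4) by (auto simp: le_max_iff_disj)
  next
    case False
    then obtain i' j' where "i = Suc i'" "j' \<in> set (es i')" "j = c + 1 + j'"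
      using j by (auto simp: prev_def split: nat.splits)
    then show ?thesis using es(4) by (fastforce simp: le_max_iff_disj)
  qed
  have "\<exists>i. \<exists>j\<in>set (?ds i). j - int i = r" using ds(5) by auto
  moreover have "\<exists>i. \<exists>j\<in>set (?ds i). j - int i = r' + c"
  proof -
    obtain i j where "j \<in> set (es i)" "j - int i = r'" using es(5) by auto
    then show ?thesis by (intro exI[of _ "Suc i"] bexI[of _ "c + 1 + j"]) (auto simp: prev_def)
  qed
  ultimately have 1: "\<exists>i. \<exists>j\<in>set (?ds i). j - int i = max r (r' + c)"
    by (simp add: max_def)
  have "\<forall>i\<ge>Suc (max N N'). ?ds i = []"
    using N N' by (auto simp: prev_def split: nat.splits)
  then have 2: "\<exists>N. \<forall>i\<ge>N. ?ds i = []" by (rule exI)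
  have 3: "?ds 0 = [0]" by (simp add: ds(1) prev_def)
  show ?thesis
    unfolding has_reg_def
    by (intro exI[of _ ?ds] exI[of _ \<Phi>] conjI allI ballI 1 2 3 \<Phi> le)
qed

lemma ideal_sum:
  assumes "ideal I (poly_ring V)" "\<And>t. t \<in> A \<Longrightarrow> h t \<in> I"
  shows "sum h A \<in> I"
  using assms(2)
  by (induction A rule: infinite_finite_induct) (simp_all add: ideal_props(2,3)[OF assms(1)])

section \<open>Squarefree monomial ideals\<close>

text \<open>The ideal generated by the squarefree monomials with supports in \<open>H\<close>.  The set \<open>H\<close> may contain
singletons, so that colon ideals of edge ideals are of the same form.\<close>

definition sqfree_ideal :: "'v set \<Rightarrow> 'v set set \<Rightarrow> ('v, 'k::field) mpoly set" where
  "sqfree_ideal V H = {f \<in> polys V. \<forall>t\<in>Poly_Mapping.keys f. \<exists>e\<in>H. e \<subseteq> Poly_Mapping.keys t}"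

definition sqfree_mon :: "'v set \<Rightarrow> ('v \<Rightarrow>\<^sub>0 nat)" where
  "sqfree_mon B = (\<Sum>b\<in>B. Poly_Mapping.single b 1)"

lemma keys_monomial_add:
  "Poly_Mapping.keys (s + t :: 'v \<Rightarrow>\<^sub>0 nat) = Poly_Mapping.keys s \<union> Poly_Mapping.keys t"
  by (auto simp: in_keys_iff lookup_add)

lemma lookup_sqfree_mon:
  "finite B \<Longrightarrow> Poly_Mapping.lookup (sqfree_mon B) b = (if b \<in> B then 1 else 0)"
  by (simp add: sqfree_mon_def lookup_sum lookup_single when_def)

lemma keys_sqfree_mon: "finite B \<Longrightarrow> Poly_Mapping.keys (sqfree_mon B) = B"
  by (auto simp: in_keys_iff lookup_sqfree_mon split: if_splits)

lemma mdeg_sqfree_mon: "finite B \<Longrightarrow> mdeg (sqfree_mon B) = card B"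
  by (simp add: mdeg_def keys_sqfree_mon lookup_sqfree_mon)

lemma sqfree_mon_divides:
  assumes "finite B"
  shows "B \<subseteq> Poly_Mapping.keys t \<longleftrightarrow> (\<exists>s. t = sqfree_mon B + s)"
proof
  assume B: "B \<subseteq> Poly_Mapping.keys t"
  have "t = sqfree_mon B + (t - sqfree_mon B)"
  proof (rule poly_mapping_eqI)
    fix b
    have "b \<in> B \<Longrightarrow> Poly_Mapping.lookup t b \<noteq> 0" using B by (auto simp: in_keys_iff)
    then show "Poly_Mapping.lookup t b = Poly_Mapping.lookup (sqfree_mon B + (t - sqfree_mon B)) b"
      by (auto simp: lookup_add lookup_minus lookup_sqfree_mon[OF assms])
  qed
  then show "\<exists>s. t = sqfree_mon B + s" by blast
qed (auto simp: keys_monomial_add keys_sqfree_mon[OF assms])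

lemma sum_terms:
  "(\<Sum>t\<in>Poly_Mapping.keys f. Poly_Mapping.single t (Poly_Mapping.lookup f t)) = (f :: ('v, 'k::field) mpoly)"
  by (rule poly_mapping_eqI) (simp add: lookup_sum lookup_single when_def in_keys_iff)

lemma keys_single_mult:
  fixes f :: "('v, 'k::field) mpoly"
  shows "Poly_Mapping.keys (Poly_Mapping.single q 1 * f) = (+) q ` Poly_Mapping.keys f"
proof -
  have "Poly_Mapping.single q 1 * f =
      Poly_Mapping.single q 1 * (\<Sum>t\<in>Poly_Mapping.keys f. Poly_Mapping.single t (Poly_Mapping.lookup f t))"
    by (simp only: sum_terms)
  also have "\<dots> = (\<Sum>t\<in>Poly_Mapping.keys f. Poly_Mapping.single (q + t) (Poly_Mapping.lookup f t))"
    by (simp add: sum_distrib_left mult_single)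
  finally have eq: "Poly_Mapping.single q 1 * f =
      (\<Sum>t\<in>Poly_Mapping.keys f. Poly_Mapping.single (q + t) (Poly_Mapping.lookup f t))" .
  have "Poly_Mapping.lookup (Poly_Mapping.single q 1 * f) (q + t) = Poly_Mapping.lookup f t" for t
    unfolding eq by (simp add: lookup_sum lookup_single when_def in_keys_iff)
  moreover have "Poly_Mapping.keys (Poly_Mapping.single q 1 * f) \<subseteq> (+) q ` Poly_Mapping.keys f"
    using keys_mult[of "Poly_Mapping.single q 1" f] by auto
  ultimately show ?thesis by (auto simp: in_keys_iff)
qed

lemma Var_eq_single: "Var w = Poly_Mapping.single (sqfree_mon {w}) 1"
  by (simp add: Var_def sqfree_mon_def)

lemma sqfree_ideal_is_ideal: "ideal (sqfree_ideal V H) (poly_ring V)"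
proof (rule ideal_poly_ringI)
  fix f g :: "('a, 'b) mpoly"
  assume fg: "f \<in> sqfree_ideal V H" "g \<in> sqfree_ideal V H"
  have "\<exists>e\<in>H. e \<subseteq> Poly_Mapping.keys t" if t: "t \<in> Poly_Mapping.keys (f + g)" for t
    using subsetD[OF keys_add t] fg by (simp add: sqfree_ideal_def) blast
  then show "f + g \<in> sqfree_ideal V H"
    using fg polys_add[of f V g] by (simp add: sqfree_ideal_def)
next
  fix a f :: "('a, 'b) mpoly"
  assume a: "a \<in> polys V" and f: "f \<in> sqfree_ideal V H"
  have "\<exists>e\<in>H. e \<subseteq> Poly_Mapping.keys t" if t: "t \<in> Poly_Mapping.keys (a * f)" for t
  proof -
    obtain s s' where s: "t = s + s'" "s' \<in> Poly_Mapping.keys f"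
      using subsetD[OF keys_mult t] by auto
    then obtain e where "e \<in> H" "e \<subseteq> Poly_Mapping.keys s'"
      using f unfolding sqfree_ideal_def by blast
    then have "e \<in> H" "e \<subseteq> Poly_Mapping.keys t"
      by (simp_all add: s(1) keys_monomial_add le_supI2)
    then show ?thesis by (rule bexI[rotated])
  qed
  then show "a * f \<in> sqfree_ideal V H"
    using f polys_mult[OF a, of f] by (simp add: sqfree_ideal_def)
qed (auto simp: sqfree_ideal_def)

lemma hcomp_closed_sqfree_ideal: "hcomp_closed (sqfree_ideal V H)"
  by (auto simp: hcomp_closed_def sqfree_ideal_def keys_hcomp polys_iff)

text \<open>Sort the terms of \<open>f\<close>: those not divisible by a generator from \<open>H\<close> are multiples of the new
generator, and they are collected in the second summand.\<close>

lemma sqfree_ideal_insert: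
  fixes f :: "('v, 'k::field) mpoly"
  assumes B: "finite B" and f: "f \<in> polys V"
  shows "f \<in> sqfree_ideal V (insert B H) \<longleftrightarrow>
    (\<exists>a\<in>polys V. f - Poly_Mapping.single (sqfree_mon B) 1 * a \<in> sqfree_ideal V H)"
proof
  assume fI: "f \<in> sqfree_ideal V (insert B H)"
  let ?T = "{t \<in> Poly_Mapping.keys f. \<not> (\<exists>e\<in>H. e \<subseteq> Poly_Mapping.keys t)}"
  have "B \<subseteq> Poly_Mapping.keys t" if "t \<in> ?T" for t
    using fI that by (simp add: sqfree_ideal_def) blast
  then have "\<forall>t\<in>?T. \<exists>s. t = sqfree_mon B + s"
    unfolding sqfree_mon_divides[OF B] by (rule ballI)
  from bchoice[OF this] obtain s where s': "\<forall>t\<in>?T. t = sqfree_mon B + s t" by (rule exE)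
  note s = bspec[OF s']
  define a where "a = (\<Sum>t\<in>?T. Poly_Mapping.single (s t) (Poly_Mapping.lookup f t))"
  have "Poly_Mapping.single (s t) (Poly_Mapping.lookup f t) \<in> polys V" if t: "t \<in> ?T" for t
  proof -
    have "Poly_Mapping.keys (s t) \<subseteq> Poly_Mapping.keys t"
      by (subst (2) s[OF t]) (simp add: keys_monomial_add)
    also have "\<dots> \<subseteq> V" using t f by (auto simp: polys_iff)
    finally show ?thesis by (simp add: polys_iff)
  qed
  then have a: "a \<in> polys V" unfolding a_def by (rule polys_sum)
  have "Poly_Mapping.single (sqfree_mon B) 1 * a =
      (\<Sum>t\<in>?T. Poly_Mapping.single (sqfree_mon B + s t) (Poly_Mapping.lookup f t))"
    unfolding a_def sum_distrib_left mult_single by simp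
  also have "\<dots> = (\<Sum>t\<in>?T. Poly_Mapping.single t (Poly_Mapping.lookup f t))"
  proof (rule sum.cong[OF refl])
    fix t assume "t \<in> ?T"
    from s[OF this] show "Poly_Mapping.single (sqfree_mon B + s t) (Poly_Mapping.lookup f t) =
        Poly_Mapping.single t (Poly_Mapping.lookup f t)"
      by (rule arg_cong[OF sym])
  qed
  finally have eq: "Poly_Mapping.single (sqfree_mon B) 1 * a =
      (\<Sum>t\<in>?T. Poly_Mapping.single t (Poly_Mapping.lookup f t))" .
  have "Poly_Mapping.lookup (f - Poly_Mapping.single (sqfree_mon B) 1 * a) t =
      (if t \<in> ?T then 0 else Poly_Mapping.lookup f t)" for t
    unfolding eq by (simp add: lookup_minus lookup_sum lookup_single when_def)
  then have "Poly_Mapping.keys (f - Poly_Mapping.single (sqfree_mon B) 1 * a) = Poly_Mapping.keys f - ?T"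
    by (auto simp: in_keys_iff split: if_splits)
  then have "f - Poly_Mapping.single (sqfree_mon B) 1 * a \<in> sqfree_ideal V H"
    using f by (auto simp: sqfree_ideal_def polys_iff)
  with a show "\<exists>a\<in>polys V. f - Poly_Mapping.single (sqfree_mon B) 1 * a \<in> sqfree_ideal V H" by blast
next
  assume "\<exists>a\<in>polys V. f - Poly_Mapping.single (sqfree_mon B) 1 * a \<in> sqfree_ideal V H"
  then obtain a where a: "f - Poly_Mapping.single (sqfree_mon B) 1 * a \<in> sqfree_ideal V H" by blast
  let ?g = "Poly_Mapping.single (sqfree_mon B) 1 * a"
  have "\<exists>e\<in>insert B H. e \<subseteq> Poly_Mapping.keys t" if t: "t \<in> Poly_Mapping.keys f" for t
  proof -
    have "t \<in> Poly_Mapping.keys (f - ?g) \<or> t \<in> Poly_Mapping.keys ?g"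
      using t by (auto simp: in_keys_iff lookup_minus)
    then show ?thesis
    proof
      assume "t \<in> Poly_Mapping.keys (f - ?g)"
      then show ?thesis using a by (auto simp: sqfree_ideal_def)
    next
      assume "t \<in> Poly_Mapping.keys ?g"
      then obtain s where "t = sqfree_mon B + s" unfolding keys_single_mult by auto
      then show ?thesis using sqfree_mon_divides[OF B] by blast
    qed
  qed
  then show "f \<in> sqfree_ideal V (insert B H)" using f by (auto simp: sqfree_ideal_def)
qed

text \<open>For squarefree monomial ideals the colon conditions of the mapping cone become conditions on supports:
\<open>H'\<close> has to describe the colon by the monomial with support \<open>B\<close> as well as by the one with support
\<open>insert w B\<close>.\<close>

lemma has_reg_insert:
  assumes reg: "has_reg V (sqfree_ideal V H :: ('v, 'k::field) mpoly set) r"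
    "has_reg V (sqfree_ideal V H' :: ('v, 'k) mpoly set) r'"
    and B: "finite B" "B \<subseteq> V" and w: "w \<in> V" "w \<notin> B"
    and colon: "\<And>A. \<exists>e\<in>H'. e \<subseteq> A \<Longrightarrow> \<exists>e\<in>H. e \<subseteq> B \<union> A"
      "\<And>A. \<exists>e\<in>H. e \<subseteq> insert w (B \<union> A) \<Longrightarrow> \<exists>e\<in>H'. e \<subseteq> A"
  shows "has_reg V (sqfree_ideal V (insert (insert w B) H) :: ('v, 'k) mpoly set) (max r (r' + int (card B)))"
proof (rule has_reg_mapping_cone[OF sqfree_ideal_is_ideal w(1) _ reg])
  let ?m = "Poly_Mapping.single (sqfree_mon B) 1 :: ('v, 'k) mpoly"
  show m: "?m \<in> homogeneous V (int (card B))"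
    using B by (simp add: homogeneous_iff polys_iff keys_sqfree_mon mdeg_sqfree_mon)
  then have mV: "?m \<in> polys V" by (rule homogeneous_polys)
  show "?m * f \<in> sqfree_ideal V H" if f: "f \<in> sqfree_ideal V H'" for f
    using f polys_mult[OF mV, of f] colon(1)
    by (auto simp: sqfree_ideal_def keys_single_mult keys_monomial_add keys_sqfree_mon[OF B(1)])
  have Vm: "Var w * (?m * f) = Poly_Mapping.single (sqfree_mon (insert w B)) 1 * f" for f
    using B(1) w(2) by (simp add: Var_eq_single mult_single flip: mult.assoc)
      (simp add: sqfree_mon_def)
  have Bw: "finite (insert w B)" using B(1) by simp
  show "f \<in> sqfree_ideal V H'" if f: "f \<in> polys V" "Var w * (?m * f) \<in> sqfree_ideal V H" for f
  proof -
    have "\<exists>e\<in>H'. e \<subseteq> Poly_Mapping.keys t" if "t \<in> Poly_Mapping.keys f" for t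
      using f(2) that colon(2)[of "Poly_Mapping.keys t"] unfolding Vm
      by (auto simp: sqfree_ideal_def keys_single_mult keys_monomial_add keys_sqfree_mon[OF Bw])
    with f(1) show ?thesis by (simp add: sqfree_ideal_def)
  qed
  show "sqfree_ideal V (insert (insert w B) H) =
      {f \<in> polys V. \<exists>a\<in>polys V. f - Var w * (?m * a) \<in> sqfree_ideal V H}"
    unfolding Vm using sqfree_ideal_insert[OF Bw, of _ V H] by (auto simp: sqfree_ideal_def)
qed

lemma has_reg_insert_variable:
  assumes "has_reg V (sqfree_ideal V H :: ('v, 'k::field) mpoly set) r" "w \<in> V" "\<And>e. e \<in> H \<Longrightarrow> w \<notin> e"
  shows "has_reg V (sqfree_ideal V (insert {w} H) :: ('v, 'k) mpoly set) r"
proof -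
  have "has_reg V (sqfree_ideal V (insert (insert w {}) H) :: ('v, 'k) mpoly set) (max r (r + int (card ({} :: 'v set))))"
  proof (rule has_reg_insert[OF assms(1) assms(1)])
    fix A assume "\<exists>e\<in>H. e \<subseteq> insert w ({} \<union> A)"
    then obtain e where "e \<in> H" "e \<subseteq> insert w A" by auto
    then show "\<exists>e\<in>H. e \<subseteq> A" using assms(3)[of e] by blast
  qed (use assms(2) in simp_all)
  then show ?thesis by simp
qed

lemma has_reg_variables:
  assumes "finite N" "N \<subseteq> V" "has_reg V (sqfree_ideal V H :: ('v, 'k::field) mpoly set) r"
    "\<And>e. e \<in> H \<Longrightarrow> e \<inter> N = {}"
  shows "has_reg V (sqfree_ideal V ((\<lambda>x. {x}) ` N \<union> H) :: ('v, 'k) mpoly set) r"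
  using assms
proof (induction N rule: finite_induct)
  case (insert x N)
  then have "has_reg V (sqfree_ideal V (insert {x} ((\<lambda>x. {x}) ` N \<union> H)) :: ('v, 'k) mpoly set) r"
    by (intro has_reg_insert_variable) auto
  then show ?case by simp
qed simp

text \<open>Here \<open>N\<close> is the neighbourhood of \<open>u\<close>, and the last assumption also says that the neighbours of \<open>v\<close> lie in
\<open>N\<close>.  The colon ideal is generated by the variables in \<open>N\<close> and the edges avoiding \<open>N\<close>; the variables
are removed by \<open>has_reg_variables\<close>.\<close>

lemma has_reg_insert_edge:
  assumes reg: "has_reg V (sqfree_ideal V E :: ('v, 'k::field) mpoly set) r"
    "has_reg V (sqfree_ideal V E' :: ('v, 'k) mpoly set) r'"
    and E': "E' = {e \<in> E. e \<inter> N = {}}"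
    and V: "finite V" "u \<in> V" "v \<in> V" "N \<subseteq> V" and "u \<noteq> v" "u \<notin> N" "v \<notin> N"
    and N: "\<And>x. x \<in> N \<Longrightarrow> {u, x} \<in> E"
      "\<And>e. e \<in> E \<Longrightarrow> u \<in> e \<or> v \<in> e \<Longrightarrow> e \<inter> N \<noteq> {}"
  shows "has_reg V (sqfree_ideal V (insert {u, v} E) :: ('v, 'k) mpoly set) (max r (r' + 1))"
proof -
  have "has_reg V (sqfree_ideal V ((\<lambda>x. {x}) ` N \<union> E') :: ('v, 'k) mpoly set) r'"
  proof (rule has_reg_variables[OF _ V(4) reg(2)])
    show "finite N" by (rule finite_subset[OF V(4,1)])
  qed (simp add: E')
  then have "has_reg V (sqfree_ideal V (insert (insert v {u}) E) :: ('v, 'k) mpoly set)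
      (max r (r' + int (card {u})))"
  proof (rule has_reg_insert[OF reg(1)])
    fix A assume "\<exists>e\<in>(\<lambda>x. {x}) ` N \<union> E'. e \<subseteq> A"
    then obtain e where e: "e \<in> (\<lambda>x. {x}) ` N \<union> E'" "e \<subseteq> A" by (rule bexE)
    from e(1) show "\<exists>e\<in>E. e \<subseteq> {u} \<union> A"
    proof
      assume "e \<in> (\<lambda>x. {x}) ` N"
      then obtain x where "x \<in> N" "e = {x}" by (rule imageE)
      with N(1)[of x] e(2) show ?thesis by (intro bexI[of _ "{u, x}"]) simp_all
    next
      assume "e \<in> E'"
      with e(2) show ?thesis unfolding E' by (intro bexI[of _ e]) auto
    qed
  next
    fix A assume "\<exists>e\<in>E. e \<subseteq> insert v ({u} \<union> A)"
    then obtain e where e: "e \<in> E" "e \<subseteq> insert v ({u} \<union> A)" by (rule bexE)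
    show "\<exists>e\<in>(\<lambda>x. {x}) ` N \<union> E'. e \<subseteq> A"
    proof (cases "e \<inter> N = {}")
      case True
      with N(2)[OF e(1)] e(2) have "e \<subseteq> A" by auto
      with True e(1) show ?thesis unfolding E' by (intro bexI[of _ e]) simp_all
    next
      case False
      then obtain x where "x \<in> e" "x \<in> N" by auto
      with e(2) \<open>u \<notin> N\<close> \<open>v \<notin> N\<close> have "x \<in> A" by auto
      with \<open>x \<in> N\<close> show ?thesis by (intro bexI[of _ "{x}"]) simp_all
    qed
  qed (use V \<open>u \<noteq> v\<close> in auto)
  then show ?thesis by (simp add: insert_commute)
qed

lemma edge_ideal_eq_sqfree_ideal:
  assumes "simple_graph G"
  shows "edge_ideal G = (sqfree_ideal (verts G) (edges G) :: ('v, 'k::field) mpoly set)"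
proof
  let ?V = "verts G" and ?I = "edge_ideal G :: ('v, 'k) mpoly set"
  have ring: "ring (poly_ring ?V :: ('v, 'k) mpoly ring)"
    by (rule cring.axioms(1)[OF cring_poly_ring])
  have gen: "Var u * Var v = Poly_Mapping.single (sqfree_mon {u, v}) (1 :: 'k)"
    if "{u, v} \<in> edges G" for u v
  proof -
    have "u \<noteq> v" using assms that by (fastforce simp: simple_graph_def)
    then show ?thesis by (simp add: Var_eq_single mult_single sqfree_mon_def)
  qed
  have V: "e \<subseteq> ?V" if "e \<in> edges G" for e
    using assms that by (auto simp: simple_graph_def)
  show "?I \<subseteq> sqfree_ideal ?V (edges G)"
    unfolding edge_ideal_def
  proof (rule ring.genideal_minimal[OF ring sqfree_ideal_is_ideal], clarify)
    fix u v assume e: "{u, v} \<in> edges G"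
    then show "Var u * Var v \<in> (sqfree_ideal ?V (edges G) :: ('v, 'k) mpoly set)"
      using V[OF e] by (simp add: gen[OF e] sqfree_ideal_def polys_iff keys_sqfree_mon) blast
  qed
  note Ip = ideal_props[OF ideal_edge_ideal[OF assms, where ?'k = 'k]]
  show "sqfree_ideal ?V (edges G) \<subseteq> ?I"
  proof
    fix f :: "('v, 'k) mpoly" assume f: "f \<in> sqfree_ideal ?V (edges G)"
    have "Poly_Mapping.single t (Poly_Mapping.lookup f t) \<in> ?I" if t: "t \<in> Poly_Mapping.keys f" for t
    proof -
      obtain e where e: "e \<in> edges G" "e \<subseteq> Poly_Mapping.keys t"
        using f t by (auto simp: sqfree_ideal_def)
      have "card e = 2" using assms e(1) by (auto simp: simple_graph_def)
      then obtain u v where uv: "e = {u, v}" by (auto simp: card_2_iff)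
      obtain s where s: "t = sqfree_mon {u, v} + s"
        using e(2) sqfree_mon_divides[of "{u, v}" t] by (auto simp: uv)
      have "Var u * Var v \<in> ?I"
        unfolding edge_ideal_def
      proof (rule subsetD[OF ring.genideal_self[OF ring]], clarify)
        fix x y assume xy: "{x, y} \<in> edges G"
        then show "Var x * Var y \<in> (polys ?V :: ('v, 'k) mpoly set)"
          using V[OF xy] by (simp add: polys_mult)
      qed (use e(1) uv in blast)
      moreover have "Poly_Mapping.keys t \<subseteq> ?V"
        using f t by (simp add: sqfree_ideal_def polys_iff)
      then have "Poly_Mapping.single s (Poly_Mapping.lookup f t) \<in> polys ?V"
        by (simp add: polys_iff s keys_monomial_add)
      ultimately have "Poly_Mapping.single s (Poly_Mapping.lookup f t) * (Var u * Var v) \<in> ?I"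
        by (rule Ip(4)[rotated])
      moreover have "Poly_Mapping.single s (Poly_Mapping.lookup f t) * (Var u * Var v) =
          Poly_Mapping.single t (Poly_Mapping.lookup f t)"
        using e(1) uv by (simp add: gen mult_single s add.commute)
      ultimately show ?thesis by simp
    qed
    then have "(\<Sum>t\<in>Poly_Mapping.keys f. Poly_Mapping.single t (Poly_Mapping.lookup f t)) \<in> ?I"
      by (rule ideal_sum[OF ideal_edge_ideal[OF assms]])
    then show "f \<in> ?I" by (simp only: sum_terms)
  qed
qed

section \<open>Building a snake edge by edge\<close>

text \<open>Subgraphs of a snake, given by the indices of the path edges, of the edges \<open>x\<^sub>i y\<^bsub>ij\<^esub>\<close> and of the edges
\<open>x\<^bsub>i+1\<^esub> y\<^bsub>ij\<^esub>\<close> that are present.  All intermediate graphs of the construction have this form.\<close>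

definition snake_edges :: "nat set \<Rightarrow> (nat \<times> nat) set \<Rightarrow> (nat \<times> nat) set \<Rightarrow> snake_vertex set set" where
  "snake_edges A B C = (\<lambda>i. {X i, X (i + 1)}) ` A \<union> (\<lambda>(i, j). {X i, Y i j}) ` B \<union>
     (\<lambda>(i, j). {X (i + 1), Y i j}) ` C"

lemma snake_edges_avoiding:
  "{e \<in> snake_edges A B C. e \<inter> N = {}} =
     snake_edges {i \<in> A. X i \<notin> N \<and> X (i + 1) \<notin> N}
       {(i, j) \<in> B. X i \<notin> N \<and> Y i j \<notin> N} {(i, j) \<in> C. X (i + 1) \<notin> N \<and> Y i j \<notin> N}"
  unfolding snake_edges_def by (intro equalityI subsetI) (auto 4 3 simp: image_iff)

abbreviation strip :: "nat \<Rightarrow> nat \<Rightarrow> (nat \<times> nat) set" where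
  "strip p k \<equiv> {1..k} \<times> {1..p}"

definition full_snake :: "nat \<Rightarrow> nat \<Rightarrow> snake_vertex set set" where
  "full_snake p k = snake_edges {1..k} (strip p k) (strip p k)"

text \<open>The snake with \<open>k - 1\<close> strips and \<open>p\<close> pendant edges at its last vertex \<open>x\<^sub>k\<close>; there are no edges for
\<open>k = 0\<close>.\<close>

definition tailed_snake :: "nat \<Rightarrow> nat \<Rightarrow> snake_vertex set set" where
  "tailed_snake p k = snake_edges {1..k - 1} (strip p k) (strip p (k - 1))"

lemma edges_triangular_snake: "edges (triangular_snake n p) = full_snake p n"
  by (auto simp: triangular_snake_def full_snake_def snake_edges_def image_iff)

lemma snake_edges_insert:
  "snake_edges (insert i A) B C = insert {X i, X (i + 1)} (snake_edges A B C)"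
  "snake_edges A (insert (i, j) B) C = insert {X i, Y i j} (snake_edges A B C)"
  "snake_edges A B (insert (i, j) C) = insert {X (i + 1), Y i j} (snake_edges A B C)"
  by (auto simp: snake_edges_def)

lemma snake_edge_cases:
  assumes "e \<in> snake_edges A B C"
  obtains i where "i \<in> A" "e = {X i, X (i + 1)}"
    | i j where "(i, j) \<in> B" "e = {X i, Y i j}"
    | i j where "(i, j) \<in> C" "e = {X (i + 1), Y i j}"
  using assms by (auto simp: snake_edges_def)

lemma snake_edgesI:
  "i \<in> A \<Longrightarrow> {X i, X (Suc i)} \<in> snake_edges A B C"
  "i \<in> A \<Longrightarrow> {X (Suc i), X i} \<in> snake_edges A B C"
  "(i, j) \<in> B \<Longrightarrow> {X i, Y i j} \<in> snake_edges A B C"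
  "(i, j) \<in> C \<Longrightarrow> {X (Suc i), Y i j} \<in> snake_edges A B C"
  by (auto simp: snake_edges_def image_iff insert_commute)

text \<open>The neighbours of \<open>x\<^sub>k\<close> in the snake with \<open>k - 1\<close> strips.\<close>

definition left_nbrs :: "nat \<Rightarrow> nat \<Rightarrow> snake_vertex set" where
  "left_nbrs p k = (if k \<ge> 2 then insert (X (k - 1)) (Y (k - 1) ` {1..p}) else {})"

lemma left_nbrs_iff [simp]:
  "X i \<in> left_nbrs p k \<longleftrightarrow> k \<ge> 2 \<and> i = k - 1"
  "Y i j \<in> left_nbrs p k \<longleftrightarrow> k \<ge> 2 \<and> i = k - 1 \<and> j \<in> {1..p}"
  by (auto simp: left_nbrs_def)

lemma verts_triangular_snake_iff [simp]:
  "X i \<in> verts (triangular_snake n p) \<longleftrightarrow> i \<in> {1..n+1}"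
  "Y i j \<in> verts (triangular_snake n p) \<longleftrightarrow> i \<in> {1..n} \<and> j \<in> {1..p}"
  unfolding triangular_snake_def by auto

lemma finite_verts_triangular_snake: "finite (verts (triangular_snake n p))"
  using simple_graph_triangular_snake[of n p] by (simp add: simple_graph_def)

text \<open>The vertex \<open>y\<^bsub>k,j+1\<^esub>\<close> is isolated before the step, so the condition on neighbourhoods holds trivially.  The path edge
\<open>x\<^sub>k x\<^bsub>k+1\<^esub>\<close> may be absent (\<open>a = k - 1\<close>, when a tailed snake is built) or present (\<open>a = k\<close>, when a new
strip is built); this does not affect which edges avoid the neighbours of \<open>x\<^sub>k\<close>.\<close>

lemma whisker_step:
  fixes n p :: nat
  defines V: "V \<equiv> verts (triangular_snake n p)"
  assumes k: "1 \<le> k" "k \<le> n" and a: "a \<in> {k - 1, k}" and "j < p"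
    and E: "has_reg V (sqfree_ideal V (snake_edges {1..a} (strip p (k - 1) \<union> {k} \<times> {1..j}) (strip p (k - 1)))
        :: (snake_vertex, 'k::field) mpoly set) r"
    and E': "has_reg V (sqfree_ideal V (tailed_snake p (k - 2)) :: (snake_vertex, 'k) mpoly set) r'"
  shows "has_reg V (sqfree_ideal V (snake_edges {1..a} (strip p (k - 1) \<union> {k} \<times> {1..Suc j}) (strip p (k - 1)))
        :: (snake_vertex, 'k) mpoly set) (max r (r' + 1))"
proof -
  let ?N = "left_nbrs p k \<union> Y k ` {1..j} \<union> (if a = k then {X (k + 1)} else {})"
  let ?E = "snake_edges {1..a} (strip p (k - 1) \<union> {k} \<times> {1..j}) (strip p (k - 1))"
  have "has_reg V (sqfree_ideal V (insert {X k, Y k (Suc j)} ?E) :: (snake_vertex, 'k) mpoly set) (max r (r' + 1))"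
  proof (rule has_reg_insert_edge[OF E E' _ finite_verts_triangular_snake[of n p, folded V], where N = ?N])
    show "tailed_snake p (k - 2) = {e \<in> ?E. e \<inter> ?N = {}}"
      unfolding snake_edges_avoiding tailed_snake_def
      using k a by (intro arg_cong3[where f = snake_edges]) auto
    show "?N \<subseteq> V" using k a \<open>j < p\<close> by (auto simp: left_nbrs_def V)
    show "{X k, x} \<in> ?E" if "x \<in> ?N" for x
    proof -
      consider "k \<ge> 2" "x = X (k - 1)" | l where "k \<ge> 2" "l \<in> {1..p}" "x = Y (k - 1) l"
        | l where "l \<in> {1..j}" "x = Y k l" | "a = k" "x = X (Suc k)"
        using \<open>x \<in> ?N\<close> by (auto simp: left_nbrs_def split: if_splits)
      then show ?thesis
      proof cases
        case 1
        then show ?thesis using snake_edgesI(2)[of "k - 1"] a by auto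
      next
        case 2
        then show ?thesis using snake_edgesI(4)[of "k - 1" l] by auto
      next
        case 3
        then show ?thesis using snake_edgesI(3)[of k l] by auto
      next
        case 4
        then show ?thesis using snake_edgesI(1)[of k] k by auto
      qed
    qed
    show "e \<inter> ?N \<noteq> {}" if "e \<in> ?E" "X k \<in> e \<or> Y k (Suc j) \<in> e" for e
      using that(1)
      by (cases rule: snake_edge_cases) (use that(2) a k in \<open>auto\<close>)
  qed (use k a \<open>j < p\<close> in \<open>auto simp: V\<close>)
  then show ?thesis
    by (simp flip: snake_edges_insert(2) add: atLeastAtMostSuc_conv)
qed

text \<open>The vertex \<open>x\<^bsub>k+1\<^esub>\<close> is isolated before the step.\<close>

lemma path_step:
  fixes n p :: nat
  defines V: "V \<equiv> verts (triangular_snake n p)"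
  assumes k: "1 \<le> k" "k \<le> n"
    and E: "has_reg V (sqfree_ideal V (full_snake p (k - 1)) :: (snake_vertex, 'k::field) mpoly set) r"
    and E': "has_reg V (sqfree_ideal V (tailed_snake p (k - 2)) :: (snake_vertex, 'k) mpoly set) r'"
  shows "has_reg V (sqfree_ideal V (snake_edges {1..k} (strip p (k - 1)) (strip p (k - 1)))
        :: (snake_vertex, 'k) mpoly set) (max r (r' + 1))"
proof -
  let ?E = "full_snake p (k - 1)"
  have "has_reg V (sqfree_ideal V (insert {X k, X (k + 1)} ?E) :: (snake_vertex, 'k) mpoly set) (max r (r' + 1))"
  proof (rule has_reg_insert_edge[OF E E' _ finite_verts_triangular_snake[of n p, folded V], where N = "left_nbrs p k"])
    show "tailed_snake p (k - 2) = {e \<in> ?E. e \<inter> left_nbrs p k = {}}"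
      unfolding snake_edges_avoiding tailed_snake_def full_snake_def
      using k by (intro arg_cong3[where f = snake_edges]) auto
    show "left_nbrs p k \<subseteq> V" using k by (auto simp: left_nbrs_def V)
    show "{X k, x} \<in> ?E" if "x \<in> left_nbrs p k" for x
    proof -
      consider "k \<ge> 2" "x = X (k - 1)" | l where "k \<ge> 2" "l \<in> {1..p}" "x = Y (k - 1) l"
        using \<open>x \<in> left_nbrs p k\<close> by (auto simp: left_nbrs_def split: if_splits)
      then show ?thesis
        unfolding full_snake_def
      proof cases
        case 1
        then show "{X k, x} \<in> snake_edges {1..k - 1} (strip p (k - 1)) (strip p (k - 1))"
          using snake_edgesI(2)[of "k - 1"] by auto
      next
        case 2
        then show "{X k, x} \<in> snake_edges {1..k - 1} (strip p (k - 1)) (strip p (k - 1))"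
          using snake_edgesI(4)[of "k - 1" l] by auto
      qed
    qed
    show "e \<inter> left_nbrs p k \<noteq> {}" if "e \<in> ?E" "X k \<in> e \<or> X (k + 1) \<in> e" for e
      using that(1) unfolding full_snake_def
      by (cases rule: snake_edge_cases) (use that(2) k in auto)
  qed (use k in \<open>auto simp: V\<close>)
  moreover have "{1..k} = insert k {1..k - 1}" using k by auto
  ultimately show ?thesis
    by (simp only: full_snake_def snake_edges_insert(1))
qed

text \<open>The only neighbour of \<open>y\<^bsub>k,j+1\<^esub>\<close> is \<open>x\<^sub>k\<close>, which is also a neighbour of \<open>x\<^bsub>k+1\<^esub>\<close>.  Removing \<open>x\<^sub>k\<close> cuts off
the new strip and turns the last old strip into pendant edges at \<open>x\<^bsub>k-1\<^esub>\<close>.\<close>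

lemma closing_step:
  fixes n p :: nat
  defines V: "V \<equiv> verts (triangular_snake n p)"
  assumes k: "1 \<le> k" "k \<le> n" and "j < p"
    and E: "has_reg V (sqfree_ideal V (snake_edges {1..k} (strip p k) (strip p (k - 1) \<union> {k} \<times> {1..j}))
        :: (snake_vertex, 'k::field) mpoly set) r"
    and E': "has_reg V (sqfree_ideal V (tailed_snake p (k - 1)) :: (snake_vertex, 'k) mpoly set) r'"
  shows "has_reg V (sqfree_ideal V (snake_edges {1..k} (strip p k) (strip p (k - 1) \<union> {k} \<times> {1..Suc j}))
        :: (snake_vertex, 'k) mpoly set) (max r (r' + 1))"
proof -
  let ?N = "insert (X k) (Y k ` {1..j})"
  let ?E = "snake_edges {1..k} (strip p k) (strip p (k - 1) \<union> {k} \<times> {1..j})"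
  have "has_reg V (sqfree_ideal V (insert {X (k + 1), Y k (Suc j)} ?E) :: (snake_vertex, 'k) mpoly set)
      (max r (r' + 1))"
  proof (rule has_reg_insert_edge[OF E E' _ finite_verts_triangular_snake[of n p, folded V], where N = ?N])
    show "tailed_snake p (k - 1) = {e \<in> ?E. e \<inter> ?N = {}}"
      unfolding snake_edges_avoiding tailed_snake_def
      using k by (intro arg_cong3[where f = snake_edges]) auto
    show "?N \<subseteq> V" using k \<open>j < p\<close> by (auto simp: V)
    show "{X (k + 1), x} \<in> ?E" if "x \<in> ?N" for x
    proof -
      consider "x = X k" | l where "l \<in> {1..j}" "x = Y k l"
        using \<open>x \<in> ?N\<close> by auto
      then show ?thesis
      proof cases
        case 1
        then show ?thesis using snake_edgesI(2)[of k] k by auto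
      next
        case 2
        then show ?thesis using snake_edgesI(4)[of k l] by auto
      qed
    qed
    show "e \<inter> ?N \<noteq> {}" if "e \<in> ?E" "X (k + 1) \<in> e \<or> Y k (Suc j) \<in> e" for e
      using that(1)
      by (cases rule: snake_edge_cases) (use that(2) k in auto)
  qed (use k \<open>j < p\<close> in \<open>auto simp: V\<close>)
  moreover have "strip p (k - 1) \<union> {k} \<times> {1..Suc j} =
      insert (k, Suc j) (strip p (k - 1) \<union> {k} \<times> {1..j})"
    by auto
  ultimately show ?thesis
    by (simp only: snake_edges_insert(3))
qed

lemma strip_Suc: "1 \<le> k \<Longrightarrow> strip p (k - 1) \<union> {k} \<times> {1..p} = strip p k"
  by auto

text \<open>The steps \<open>j = 0, \<dots>, p - 1\<close> have the same colon graph, so only the first one can raise the maximum; \<open>p \<ge> 1\<close> guarantees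
that it takes place.\<close>

lemma iterate_max:
  fixes r s :: int
  assumes "1 \<le> p" "P 0 r" "\<And>j r. j < p \<Longrightarrow> P j r \<Longrightarrow> P (Suc j) (max r s)"
  shows "P (p :: nat) (max r s)"
proof -
  have "P (Suc j) (max r s)" if "j < p" for j
    using that
  proof (induction j)
    case 0
    then show ?case using assms(2,3) by blast
  next
    case (Suc j)
    then show ?case using assms(3)[of "Suc j" "max r s"] by simp
  qed
  from this[of "p - 1"] assms(1) show ?thesis by simp
qed

text \<open>Truncated subtraction turns \<open>h\<^bsub>k-2\<^esub>\<close> into \<open>h\<^sub>0 = 0\<close> for \<open>k = 1\<close>, which is right because no edge
survives there.  The snake without strips has no edges; its regularity is \<open>0\<close> and does not
follow the general pattern.\<close>

lemma snake_reg:
  fixes n p :: nat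
  defines V: "V \<equiv> verts (triangular_snake n p)"
  assumes p: "1 \<le> p" and "k \<le> n"
  shows "has_reg V (sqfree_ideal V (full_snake p k) :: (snake_vertex, 'k::field) mpoly set)
      (if k = 0 then 0 else int (k div 2) + 1) \<and>
    has_reg V (sqfree_ideal V (tailed_snake p k) :: (snake_vertex, 'k) mpoly set) (int ((k + 1) div 2))"
  using \<open>k \<le> n\<close>
proof (induction k rule: less_induct)
  case (less k)
  show ?case
  proof (cases "k = 0")
    case True
    have "sqfree_ideal V {} = ({0} :: (snake_vertex, 'k) mpoly set)"
      by (auto simp: sqfree_ideal_def)
    moreover have "full_snake p 0 = {}" "tailed_snake p 0 = {}"
      by (simp_all add: full_snake_def tailed_snake_def snake_edges_def)
    ultimately show ?thesis
      using True has_reg_zero_ideal[of V, where ?'k = 'k] by simp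
  next
    case False
    define full where "full = (if k - 1 = 0 then 0 else int ((k - 1) div 2) + 1)"
    define tail2 where "tail2 = int ((k - 2 + 1) div 2)"
    define tail1 where "tail1 = int ((k - 1 + 1) div 2)"
    have k: "1 \<le> k" "k \<le> n" using False less.prems by auto
    have full: "has_reg V (sqfree_ideal V (full_snake p (k - 1)) :: (snake_vertex, 'k) mpoly set) full"
      and tail1: "has_reg V (sqfree_ideal V (tailed_snake p (k - 1)) :: (snake_vertex, 'k) mpoly set) tail1"
      using less.IH[of "k - 1"] k unfolding full_def tail1_def by simp_all
    have tail2: "has_reg V (sqfree_ideal V (tailed_snake p (k - 2)) :: (snake_vertex, 'k) mpoly set) tail2"
      using less.IH[of "k - 2"] k unfolding tail2_def by simp
    have whiskers: "has_reg V (sqfree_ideal V (snake_edges {1..a} (strip p k) (strip p (k - 1)))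
        :: (snake_vertex, 'k) mpoly set) (max r (tail2 + 1))"
      if a: "a \<in> {k - 1, k}" and r: "has_reg V (sqfree_ideal V (snake_edges {1..a} (strip p (k - 1)) (strip p (k - 1)))
        :: (snake_vertex, 'k) mpoly set) r" for a r
    proof -
      have "has_reg V (sqfree_ideal V (snake_edges {1..a} (strip p (k - 1) \<union> {k} \<times> {1..p}) (strip p (k - 1)))
        :: (snake_vertex, 'k) mpoly set) (max r (tail2 + 1))"
        by (rule iterate_max[where P = "\<lambda>j. has_reg V (sqfree_ideal V
              (snake_edges {1..a} (strip p (k - 1) \<union> {k} \<times> {1..j}) (strip p (k - 1))) :: (snake_vertex, 'k) mpoly set)", OF p])
          (use r whisker_step[OF k a _ _ tail2[unfolded V]] in \<open>simp_all add: V\<close>)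
      then show ?thesis by (simp only: strip_Suc[OF k(1)])
    qed
    have tailed: "has_reg V (sqfree_ideal V (tailed_snake p k) :: (snake_vertex, 'k) mpoly set) (max full (tail2 + 1))"
      using whiskers[of "k - 1"] full by (simp add: tailed_snake_def full_snake_def)
    have "has_reg V (sqfree_ideal V (snake_edges {1..k} (strip p k) (strip p (k - 1))) :: (snake_vertex, 'k) mpoly set)
        (max (max full (tail2 + 1)) (tail2 + 1))"
      by (rule whiskers) (use path_step[OF k full[unfolded V] tail2[unfolded V]] in \<open>simp_all add: V\<close>)
    then have r: "has_reg V (sqfree_ideal V (snake_edges {1..k} (strip p k) (strip p (k - 1))) :: (snake_vertex, 'k) mpoly set)
        (max full (tail2 + 1))"
      by simp
    have "has_reg V (sqfree_ideal V (snake_edges {1..k} (strip p k) (strip p (k - 1) \<union> {k} \<times> {1..p}))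
        :: (snake_vertex, 'k) mpoly set) (max (max full (tail2 + 1)) (tail1 + 1))"
      by (rule iterate_max[where P = "\<lambda>j. has_reg V (sqfree_ideal V
            (snake_edges {1..k} (strip p k) (strip p (k - 1) \<union> {k} \<times> {1..j})) :: (snake_vertex, 'k) mpoly set)", OF p])
        (use r closing_step[OF k _ _ tail1[unfolded V]] in \<open>simp_all add: V\<close>)
    then have "has_reg V (sqfree_ideal V (full_snake p k) :: (snake_vertex, 'k) mpoly set)
        (max (max full (tail2 + 1)) (tail1 + 1))"
      by (simp only: strip_Suc[OF k(1)] full_snake_def)
    moreover have "max full (tail2 + 1) = int ((k + 1) div 2)"
      using k unfolding full_def tail2_def by (auto simp: max_def)
    moreover have "max (int ((k + 1) div 2)) (tail1 + 1) = int (k div 2) + 1"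
      using k unfolding tail1_def by (auto simp: max_def) 
    ultimately show ?thesis using tailed False by simp
  qed
qed

theorem theorem3p3:
  fixes n p :: nat
  assumes "n \<ge> 1" and "p \<ge> 1"
  shows "regularity (verts (triangular_snake n p))
           (quotient_module (verts (triangular_snake n p))
              (edge_ideal (triangular_snake n p) :: (snake_vertex, 'k::field) mpoly set))
         = \<lceil>(real n + 1) / 2\<rceil>"
proof -
  have "has_reg (verts (triangular_snake n p)) (edge_ideal (triangular_snake n p) :: (snake_vertex, 'k) mpoly set)
      (int (n div 2) + 1)"
    using snake_reg[OF assms(2), of n n, where ?'k = 'k] assms(1)
    by (simp add: edge_ideal_eq_sqfree_ideal[OF simple_graph_triangular_snake] edges_triangular_snake)
  then have "regularity (verts (triangular_snake n p))
      (quotient_module (verts (triangular_snake n p)) (edge_ideal (triangular_snake n p) :: (snake_vertex, 'k) mpoly set))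
      = int (n div 2) + 1"
    by (intro regularity_eq_has_reg ideal_edge_ideal simple_graph_triangular_snake)
      (simp_all add: edge_ideal_eq_sqfree_ideal[OF simple_graph_triangular_snake] hcomp_closed_sqfree_ideal)
  also have "int (n div 2) + 1 = \<lceil>(real n + 1) / 2\<rceil>"
  proof (cases "even n")
    case True
    then obtain m where n: "n = 2 * m" by blast
    have "\<lceil>(real n + 1) / 2\<rceil> = int m + 1"
      by (rule ceiling_unique) (simp_all add: n field_simps)
    then show ?thesis by (simp add: n)
  next
    case False
    then obtain m where n: "n = 2 * m + 1" by (blast elim: oddE)
    have "\<lceil>(real n + 1) / 2\<rceil> = int m + 1"
      by (rule ceiling_unique) (simp_all add: n field_simps)
    then show ?thesis by (simp add: n)
  qed
  finally show ?thesis .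
qed

end
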